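(* The actions of $\Gamma=\mathrm{Gal}(\overline{\mathbb{Q}}/\mathbb{Q})$ on $XDBP$ and on $DBP$ by twisting coefficients, $f\mapsto f^{\sigma}$, are both faithful.
   Context: Fix an embedding $\overline{\mathbb{Q}}\subset\mathbb{C}$. For a polynomial $f$, $C_f$ is its set of critical points in $\mathbb{C}$ and $P_f=\overline{\bigcup_{n>0}f^{\circ n}(C_f)}$. A (clean) Belyi polynomial is a polynomial $f\in\overline{\mathbb{Q}}[z]$ all of whose critical values lie in $\{0,1\}$ and which has local degree exactly $2$ at every point of $f^{-1}(1)$. $DBP$ is the set of Belyi polynomials of degree at least $3$ with $P_f\subset\{0,1\}$. $XDBP$ is the set of $f\in DBP$ with $f(0)=f(1)=0$ and local degree of $f$ equal to one at both $0$ and $1$. For $\sigma\in\Gamma$ and $f(z)=\sum a_iz^i$, $f^\sigma(z)=\sum\sigma(a_i)z^i$; this action preserves $DBP$ and $XDBP$. An action on a set is faithful if every nonidentity $\sigma$ moves some element of the set. *)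

theory Defs
  imports
    "HOL-Algebra.Group_Action"
    "HOL-Analysis.Analysis"
    "HOL-Computational_Algebra.Polynomial"
begin

text \<open>
  The embedding of the algebraic closure of the rationals into \<open>\<complex>\<close> is fixed by taking
  the field of algebraic complex numbers.
\<close>

definition Qbar :: "complex set"
  where "Qbar = {z. algebraic z}"

text \<open>
  As in \<^const>\<open>BijGroup\<close>, an automorphism is a function on all of \<open>\<complex>\<close> that is
  \<^const>\<open>undefined\<close> off \<open>Qbar\<close>, so distinct elements differ on \<open>Qbar\<close>;
  the product is composition.
\<close>

definition absolute_galois_group :: "(complex \<Rightarrow> complex) monoid"
  where "absolute_galois_group = (BijGroup Qbar)
    \<lparr>carrier := {\<sigma> \<in> Bij Qbar.
       (\<forall>x\<in>Qbar. \<forall>y\<in>Qbar. \<sigma> (x + y) = \<sigma> x + \<sigma> y) \<and>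
       (\<forall>x\<in>Qbar. \<forall>y\<in>Qbar. \<sigma> (x * y) = \<sigma> x * \<sigma> y) \<and>
       (\<forall>q\<in>\<rat>. \<sigma> q = q)}\<rparr>"

definition critical_points :: "complex poly \<Rightarrow> complex set"
  where "critical_points f = {z. poly (pderiv f) z = 0}"

definition critical_values :: "complex poly \<Rightarrow> complex set"
  where "critical_values f = poly f ` critical_points f"

definition postcritical_set :: "complex poly \<Rightarrow> complex set"
  where "postcritical_set f = closure (\<Union>n\<in>{0<..}. (poly f ^^ n) ` critical_points f)"

text \<open>
  The local degree at \<open>z\<close> is the multiplicity of \<open>z\<close> as a solution of
  \<open>f w = f z\<close>. It is meaningful only for nonconstant \<open>f\<close>.
\<close>

definition local_degree :: "complex poly \<Rightarrow> complex \<Rightarrow> nat"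
  where "local_degree f z = Polynomial.order z (f - [:poly f z:])"

definition belyi_polynomial :: "complex poly \<Rightarrow> bool"
  where "belyi_polynomial f \<longleftrightarrow>
    (\<forall>i. coeff f i \<in> Qbar) \<and>
    critical_values f \<subseteq> {0, 1} \<and>
    (\<forall>z. poly f z = 1 \<longrightarrow> local_degree f z = 2)"

definition DBP :: "complex poly set"
  where "DBP = {f. belyi_polynomial f \<and> degree f \<ge> 3 \<and> postcritical_set f \<subseteq> {0, 1}}"

definition XDBP :: "complex poly set"
  where "XDBP = {f \<in> DBP. poly f 0 = 0 \<and> poly f 1 = 0 \<and>
                          local_degree f 0 = 1 \<and> local_degree f 1 = 1}"

definition twist :: "(complex \<Rightarrow> complex) \<Rightarrow> complex poly \<Rightarrow> complex poly"
  where "twist \<sigma> f = map_poly \<sigma> f"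

text \<open>
  For a group action, the library's \<^locale>\<open>faithful_action\<close> (injectivity of the action
  homomorphism) says that every nonidentity group element moves some point.
\<close>

lemma faithful_action_iff_moves:
  "faithful_action G E \<phi> \<longleftrightarrow>
     group_action G E \<phi> \<and>
     (\<forall>g\<in>carrier G. g \<noteq> \<one>\<^bsub>G\<^esub> \<longrightarrow> (\<exists>x\<in>E. \<phi> g x \<noteq> x))"
proof (cases "group_action G E \<phi>")
  case True
  then interpret group_hom G "BijGroup E" \<phi>
    by (rule group_action.group_hom)
  have "\<phi> g = \<one>\<^bsub>BijGroup E\<^esub> \<longleftrightarrow> (\<forall>x\<in>E. \<phi> g x = x)" if "g \<in> carrier G" for g
  proof -
    have "\<phi> g \<in> extensional E"
      using hom_closed[OF that] by (simp add: BijGroup_def Bij_def)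
    then show ?thesis
      by (auto simp: BijGroup_def extensional_def fun_eq_iff restrict_def)
  qed
  then show ?thesis
    using True inj_on_one_iff
    by (auto simp: faithful_action_def faithful_action_axioms_def)
next
  case False
  then show ?thesis
    by (simp add: faithful_action_def)
qed

end

theory Submission
  imports Defs "HOL-Computational_Algebra.Fundamental_Theorem_Algebra"
begin

text \<open>
  Suppose \<open>\<sigma> \<alpha> \<noteq> \<alpha>\<close>. Following Lenstra, take \<open>P\<close> with \<open>P'\<close> proportional to
  \<open>z\<^sup>3 (z - 1)\<^sup>2 (z - \<alpha>)\<close>, and use Belyi's theorem to get a rational polynomial \<open>B\<close> such that
  the critical values of \<open>g = B \<circ> P\<close> lie in \<open>{0, 1}\<close>. Counting the points over 0 and 1, at least two of
  them, \<open>p\<close> and \<open>q\<close>, are noncritical. Let \<open>A\<close> be the affine map sending 0 to \<open>p\<close> and 1 to \<open>q\<close>; then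
  \<open>f = 4g(1 - g) \<circ> A\<close> is in \<^const>\<open>XDBP\<close>. Write \<open>f = H \<circ> R\<close> with \<open>R = P \<circ> A\<close> and \<open>H = 4B(1 - B)\<close>
  rational. If \<open>f\<^sup>\<sigma> = f\<close>, then \<open>H \<circ> R\<^sup>\<sigma> = H \<circ> R\<close>, so \<open>R\<^sup>\<sigma>\<close> and \<open>R\<close> differ by an affine map on the left
  and have the same critical points with the same multiplicities. The multiplicities 3, 2 and 1
  identify the preimages of 0, 1 and \<open>\<alpha>\<close> under \<open>A\<close> with those of 0, 1 and \<open>\<sigma> \<alpha>\<close> under \<open>A\<^sup>\<sigma>\<close>; the
  first two force \<open>A\<^sup>\<sigma> = A\<close>, and then the third gives \<open>\<sigma> \<alpha> = \<alpha>\<close>, a contradiction.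
\<close>

section \<open>Algebraic numbers\<close>

text \<open>Indexing by numbers keeps repeated vectors visible: a repetition
  \<open>v i = v j\<close> is itself a relation, and otherwise there are too many distinct vectors
  in the span of \<open>T\<close>. Applied to powers of a complex number and to powers of one
  polynomial modulo another.\<close>

lemma (in vector_space) dependent_family:
  assumes "finite T" and "\<And>i. v i \<in> span T"
  shows "\<exists>a. (\<exists>i\<le>card T. a i \<noteq> 0) \<and> (\<Sum>i\<le>card T. scale (a i) (v i)) = 0"
proof (cases "inj_on v {..card T}")
  case False
  then obtain i j where ij: "i \<le> card T" "j \<le> card T" "i \<noteq> j" "v i = v j"
    by (auto simp: inj_on_def)
  let ?a = "\<lambda>k. (if k = i then 1 else 0) - (if k = j then 1 else 0 :: 'a)"
  have "(\<Sum>k\<le>card T. scale (?a k) (v k)) = v i - v j"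
    using ij by (simp add: scale_left_diff_distrib sum_subtractf if_distrib[of "\<lambda>c. scale c _"]
        cong: if_cong)
  then show ?thesis
    using ij by (intro exI[of _ ?a]) auto
next
  case True
  have "\<not> independent (v ` {..card T})"
    using independent_span_bound[OF assms(1), of "v ` {..card T}"] assms(2) card_image[OF True]
    by auto
  then obtain u where u: "\<exists>w\<in>v ` {..card T}. u w \<noteq> 0"
      "(\<Sum>w\<in>v ` {..card T}. scale (u w) w) = 0"
    by (auto simp: dependent_finite)
  then have "(\<Sum>i\<le>card T. scale (u (v i)) (v i)) = 0"
    by (simp add: sum.reindex[OF True])
  with u(1) show ?thesis
    by (intro exI[of _ "u \<circ> v"]) auto
qed

interpretation cq: vector_space "\<lambda>(q::rat) (z::complex). of_rat q * z"
  by unfold_locales (auto simp: algebra_simps of_rat_add of_rat_mult)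

lemma algebraic_if_powers_in_span:
  fixes z :: complex
  assumes "finite T" and "\<And>i. z ^ i \<in> cq.span T"
  shows "algebraic z"
proof -
  from cq.dependent_family[of T "\<lambda>i. z ^ i", OF assms]
  obtain a :: "nat \<Rightarrow> rat" and k where a: "k \<le> card T" "a k \<noteq> 0"
    "(\<Sum>i\<le>card T. of_rat (a i) * z ^ i) = 0"
    by (elim exE conjE)
  define p :: "complex poly" where "p = (\<Sum>i\<le>card T. monom (of_rat (a i)) i)"
  have c: "coeff p i = (if i \<le> card T then of_rat (a i) else 0)" for i
    by (simp add: p_def coeff_sum)
  show ?thesis
  proof (rule algebraicI')
    show "coeff p i \<in> \<rat>" for i by (simp add: c)
    show "p \<noteq> 0" using a c[of k] by auto
    show "poly p z = 0" using a by (simp add: p_def poly_sum poly_monom)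
  qed
qed

text \<open>Encodes a subring of the complex numbers of finite dimension over the rationals by a
  spanning set. Powers of an element stay in the subring, which makes the element algebraic.\<close>

definition finite_ring_span :: "complex set \<Rightarrow> bool"
  where "finite_ring_span T \<longleftrightarrow> finite T \<and> 1 \<in> cq.span T \<and>
    (\<forall>x\<in>cq.span T. \<forall>y\<in>cq.span T. x * y \<in> cq.span T)"

lemma
  assumes "finite_ring_span T"
  shows finite_ring_span_finite: "finite T"
    and finite_ring_span_one: "1 \<in> cq.span T"
    and finite_ring_span_mult: "x \<in> cq.span T \<Longrightarrow> y \<in> cq.span T \<Longrightarrow> x * y \<in> cq.span T"
  using assms unfolding finite_ring_span_def by blast+

lemma finite_ring_span_imp_algebraic:
  assumes "finite_ring_span T" "z \<in> cq.span T"
  shows "algebraic z"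
proof (rule algebraic_if_powers_in_span[of T])
  show "finite T" using assms(1) by (rule finite_ring_span_finite)
  show "z ^ i \<in> cq.span T" for i
  proof (induction i)
    case 0
    show ?case using finite_ring_span_one[OF assms(1)] by simp
  next
    case (Suc i)
    then show ?case using finite_ring_span_mult[OF assms] by simp
  qed
qed

text \<open>Multiplication by a fixed \<open>c\<close> is linear over the rationals, so products
  need checking on generators only.\<close>

lemma mult_span_closed:
  fixes c :: complex
  assumes "x \<in> cq.span T" "\<And>t. t \<in> T \<Longrightarrow> t * c \<in> cq.span U"
  shows "x * c \<in> cq.span U"
  using assms(1)
proof (induction rule: cq.span_induct_alt)
  case base
  show ?case by (simp add: cq.span_zero)
next
  case (step q t y)
  have "of_rat q * (t * c) + y * c \<in> cq.span U"
    using step assms(2) by (intro cq.span_add cq.span_scale)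
  then show ?case by (simp add: algebra_simps)
qed

text \<open>The monic equation of degree n rewrites z^n in lower powers, so the finitely many
  products t z^j with t in \<open>T\<close> and j < n span a ring containing
  \<open>z\<close>.\<close>

lemma finite_ring_span_adjoin:
  assumes R: "finite_ring_span T" and p: "\<And>i. coeff p i \<in> cq.span T" "lead_coeff p = 1"
    and z: "poly p z = 0"
  shows "\<exists>U. finite_ring_span U \<and> cq.span T \<subseteq> cq.span U \<and> z \<in> cq.span U"
proof -
  define n where "n = degree p"
  define U where "U = (\<lambda>(t, j). t * z ^ j) ` (T \<times> {..<n})"
  note T1 = finite_ring_span_one[OF R] and Tm = finite_ring_span_mult[OF R]
  have n0: "n > 0"
  proof (rule ccontr)
    assume "\<not> n > 0"
    then have "degree p = 0" by (simp add: n_def)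
    then obtain c where "p = [:c:]" by (rule degree_eq_zeroE)
    with p z show False by simp
  qed
  have zn: "z ^ n = - (\<Sum>i<n. coeff p i * z ^ i)"
    using z p(2) by (simp add: poly_altdef n_def lessThan_Suc_atMost[symmetric] add_eq_0_iff)
  \<comment> \<open>Strong induction on \<open>j\<close>: once \<open>j\<close> reaches
    \<open>n\<close>, substituting for z^n leaves only exponents below \<open>j\<close>, with
    coefficients still in the span of \<open>T\<close>.\<close>
  have key: "r * z ^ j \<in> cq.span U" if "r \<in> cq.span T" for r j
    using that
  proof (induction j arbitrary: r rule: less_induct)
    case (less j)
    show ?case
    proof (cases "j < n")
      case True
      then show ?thesis
        by (intro mult_span_closed[OF less.prems] cq.span_base) (auto simp: U_def)
    next
      case False
      then have "r * z ^ j = r * z ^ (j - n) * z ^ n"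
        by (simp add: power_add[symmetric] mult.assoc)
      also have "\<dots> = - (\<Sum>i<n. (r * coeff p i) * z ^ (j - n + i))"
        by (simp add: zn sum_distrib_left power_add algebra_simps)
      also have "\<dots> \<in> cq.span U"
        using False less.prems p(1) by (intro cq.span_neg cq.span_sum less.IH Tm) auto
      finally show ?thesis .
    qed
  qed
  have "x * y \<in> cq.span U" if xy: "x \<in> cq.span U" "y \<in> cq.span U" for x y
  proof (rule mult_span_closed[OF xy(1)])
    fix u assume "u \<in> U"
    then obtain t j where u: "t \<in> T" "u = t * z ^ j" by (auto simp: U_def)
    have "y * u \<in> cq.span U"
    proof (rule mult_span_closed[OF xy(2)])
      fix u' assume "u' \<in> U"
      then obtain t' j' where u': "t' \<in> T" "u' = t' * z ^ j'" by (auto simp: U_def)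
      have "(t' * t) * z ^ (j' + j) \<in> cq.span U"
        by (intro key Tm cq.span_base u u')
      then show "u' * u \<in> cq.span U" by (simp add: u u' power_add algebra_simps)
    qed
    then show "u * y \<in> cq.span U" by (simp add: mult.commute)
  qed
  moreover have "finite U" using finite_ring_span_finite[OF R] by (simp add: U_def)
  ultimately have "finite_ring_span U"
    using key[OF T1, of 0] unfolding finite_ring_span_def by simp
  moreover have "cq.span T \<subseteq> cq.span U" using key[of _ 0] by auto
  ultimately show ?thesis using key[OF T1, of 1] by auto
qed

text \<open>The numbers are adjoined one at a time, starting from the rationals. Sums and products
  of algebraic numbers then live in a common ring of this kind.\<close>

lemma finite_ring_span_of_algebraic:
  assumes "finite A" "\<And>a. a \<in> A \<Longrightarrow> algebraic a"
  shows "\<exists>T. finite_ring_span T \<and> A \<subseteq> cq.span T"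
  using assms
proof (induction rule: finite_induct)
  case empty
  have "finite_ring_span {1}"
    unfolding finite_ring_span_def
  proof (intro conjI ballI)
    fix x y assume "x \<in> cq.span {1}" "y \<in> cq.span {1}"
    then show "x * y \<in> cq.span {1}"
      using mult_span_closed[of x "{1}" y "{1}"] by auto
  qed (auto intro: cq.span_base)
  then show ?case by auto
next
  case (insert a A)
  then obtain T where T: "finite_ring_span T" "A \<subseteq> cq.span T" by auto
  obtain p where p: "\<And>i. coeff p i \<in> \<rat>" "p \<noteq> 0" "poly p a = 0"
    using insert.prems[of a] algebraicE'[of a] by (metis insertI1 algebraic_altdef)
  \<comment> \<open>Normalising keeps the coefficients rational, and rationals lie in the span
    because 1 does.\<close>
  define q where "q = smult (inverse (lead_coeff p)) p"
  have "coeff q i \<in> cq.span T" for i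
  proof -
    have "coeff q i \<in> \<rat>" using p(1) by (auto simp: q_def)
    then obtain r where "coeff q i = of_rat r" by (auto elim: Rats_cases)
    moreover have "of_rat r * 1 \<in> cq.span T"
      by (intro cq.span_scale finite_ring_span_one T(1))
    ultimately show ?thesis by simp
  qed
  moreover have "lead_coeff q = 1" "poly q a = 0" using p by (auto simp: q_def)
  ultimately obtain U where "finite_ring_span U" "cq.span T \<subseteq> cq.span U" "a \<in> cq.span U"
    using finite_ring_span_adjoin[OF T(1)] by blast
  with T show ?case by (intro exI[of _ U]) auto
qed

lemma algebraic_add_complex:
  fixes x y :: complex
  assumes "algebraic x" "algebraic y"
  shows "algebraic (x + y)"
proof -
  obtain T where T: "finite_ring_span T" "{x, y} \<subseteq> cq.span T"
    using finite_ring_span_of_algebraic[of "{x, y}"] assms by auto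
  show ?thesis
    using T(2) by (intro finite_ring_span_imp_algebraic[OF T(1)] cq.span_add[of x T y]) blast+
qed

lemma algebraic_mult_complex:
  fixes x y :: complex
  assumes "algebraic x" "algebraic y"
  shows "algebraic (x * y)"
proof -
  obtain T where T: "finite_ring_span T" "{x, y} \<subseteq> cq.span T"
    using finite_ring_span_of_algebraic[of "{x, y}"] assms by auto
  have "x * y \<in> cq.span T" using finite_ring_span_mult[OF T(1)] T(2) by blast
  with T(1) show ?thesis by (rule finite_ring_span_imp_algebraic)
qed

text \<open>The normalised coefficients lie in a ring of finite dimension over the rationals, and
  \<open>z\<close> is integral over it. This is why critical points and fibres over algebraic values
  are algebraic.\<close>

lemma algebraic_root_of_algebraic_poly:
  fixes p :: "complex poly"
  assumes "\<And>i. algebraic (coeff p i)" "p \<noteq> 0" "poly p z = 0"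
  shows "algebraic z"
proof -
  define q where "q = smult (inverse (lead_coeff p)) p"
  have alg: "algebraic (coeff q i)" for i
    using assms(1) by (auto simp: q_def intro!: algebraic_mult_complex)
  have q1: "lead_coeff q = 1" "poly q z = 0" using assms by (auto simp: q_def)
  obtain T where T: "finite_ring_span T" "coeff q ` {..degree q} \<subseteq> cq.span T"
    using finite_ring_span_of_algebraic[of "coeff q ` {..degree q}"] alg by auto
  have "coeff q i \<in> cq.span T" for i
    using T(2) by (cases "i \<le> degree q") (auto simp: coeff_eq_0 cq.span_zero)
  then obtain U where "finite_ring_span U" "z \<in> cq.span U"
    using finite_ring_span_adjoin[OF T(1)] q1 by blast
  then show ?thesis by (rule finite_ring_span_imp_algebraic)
qed

section \<open>Polynomials over a subring\<close>

definition polys_over :: "'a::zero set \<Rightarrow> 'a poly set"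
  where "polys_over K = {p. \<forall>i. coeff p i \<in> K}"

text \<open>The rationals and \<open>Qbar\<close> occur as subsets of the complex numbers rather
  than as types, so coefficients are tracked by closure rules.\<close>

locale subring_set =
  fixes K :: "'a::idom set"
  assumes zero_mem: "0 \<in> K" and one_mem: "1 \<in> K"
    and add_mem: "x \<in> K \<Longrightarrow> y \<in> K \<Longrightarrow> x + y \<in> K"
    and mult_mem: "x \<in> K \<Longrightarrow> y \<in> K \<Longrightarrow> x * y \<in> K"
    and uminus_mem: "x \<in> K \<Longrightarrow> - x \<in> K"
begin

lemma diff_mem: "x \<in> K \<Longrightarrow> y \<in> K \<Longrightarrow> x - y \<in> K"
  using add_mem[of x "- y"] uminus_mem[of y] by simp

lemma sum_mem: "(\<And>i. i \<in> A \<Longrightarrow> f i \<in> K) \<Longrightarrow> sum f A \<in> K"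
  by (induction A rule: infinite_finite_induct) (auto intro: zero_mem add_mem)

lemma power_mem: "x \<in> K \<Longrightarrow> x ^ n \<in> K"
  by (induction n) (auto intro: one_mem mult_mem)

lemma of_nat_mem: "of_nat n \<in> K"
  by (induction n) (auto intro: zero_mem one_mem add_mem)

lemma pCons_over: "c \<in> K \<Longrightarrow> p \<in> polys_over K \<Longrightarrow> pCons c p \<in> polys_over K"
  by (auto simp: polys_over_def coeff_pCons split: nat.splits)

lemma zero_over: "0 \<in> polys_over K"
  by (simp add: polys_over_def zero_mem)

lemma one_over: "1 \<in> polys_over K"
  by (simp add: one_pCons pCons_over one_mem zero_over)

lemma const_over: "c \<in> K \<Longrightarrow> [:c:] \<in> polys_over K"
  by (simp add: pCons_over zero_over)

lemma add_over: "p \<in> polys_over K \<Longrightarrow> q \<in> polys_over K \<Longrightarrow> p + q \<in> polys_over K"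
  by (simp add: polys_over_def add_mem)

lemma diff_over: "p \<in> polys_over K \<Longrightarrow> q \<in> polys_over K \<Longrightarrow> p - q \<in> polys_over K"
  by (simp add: polys_over_def diff_mem)

lemma mult_over: "p \<in> polys_over K \<Longrightarrow> q \<in> polys_over K \<Longrightarrow> p * q \<in> polys_over K"
  by (simp add: polys_over_def coeff_mult sum_mem mult_mem)

lemma power_over: "p \<in> polys_over K \<Longrightarrow> p ^ n \<in> polys_over K"
  by (induction n) (auto intro: one_over mult_over)

lemma smult_over: "c \<in> K \<Longrightarrow> p \<in> polys_over K \<Longrightarrow> smult c p \<in> polys_over K"
  by (simp add: polys_over_def mult_mem)

lemma pderiv_over: "p \<in> polys_over K \<Longrightarrow> pderiv p \<in> polys_over K"
  by (simp add: polys_over_def coeff_pderiv mult_mem of_nat_mem del: of_nat_Suc)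

lemma poly_mem: "p \<in> polys_over K \<Longrightarrow> x \<in> K \<Longrightarrow> poly p x \<in> K"
  by (simp add: polys_over_def poly_altdef sum_mem mult_mem power_mem)

lemma pCons_overD: "pCons c p \<in> polys_over K \<Longrightarrow> c \<in> K \<and> p \<in> polys_over K"
  unfolding polys_over_def mem_Collect_eq by (metis coeff_pCons_0 coeff_pCons_Suc)

lemma pcompose_over:
  assumes "p \<in> polys_over K" "q \<in> polys_over K"
  shows "pcompose p q \<in> polys_over K"
  using assms(1)
proof (induction p)
  case (pCons c p)
  then show ?case
    using pCons_overD[of c p] assms(2)
    by (auto simp: pcompose_pCons intro!: add_over mult_over const_over)
qed (simp add: zero_over)

end

text \<open>The laws for \<open>h\<close> are required on \<open>K\<close> only, because a Galois
  automorphism takes the value \<open>undefined\<close> off \<open>Qbar\<close>.\<close>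

locale subring_hom = subring_set K for K :: "'a::idom set" +
  fixes h :: "'a \<Rightarrow> 'b::idom"
  assumes hom_add: "x \<in> K \<Longrightarrow> y \<in> K \<Longrightarrow> h (x + y) = h x + h y"
    and hom_mult: "x \<in> K \<Longrightarrow> y \<in> K \<Longrightarrow> h (x * y) = h x * h y"
    and hom_one: "h 1 = 1"
begin

lemma hom_zero: "h 0 = 0"
  using hom_add[OF zero_mem zero_mem] by (metis add_0 add_cancel_left_left)

lemma hom_uminus: "x \<in> K \<Longrightarrow> h (- x) = - h x"
  using hom_add[of x "- x"] uminus_mem[of x] hom_zero by (simp add: eq_neg_iff_add_eq_0 add.commute)

lemma hom_of_nat: "h (of_nat n) = of_nat n"
  by (induction n) (simp_all add: hom_zero hom_one hom_add one_mem of_nat_mem)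

lemma hom_sum: "(\<And>i. i \<in> A \<Longrightarrow> f i \<in> K) \<Longrightarrow> h (sum f A) = (\<Sum>i\<in>A. h (f i))"
  by (induction A rule: infinite_finite_induct) (auto simp: hom_zero hom_add sum_mem)

lemma coeff_map_hom [simp]: "coeff (map_poly h p) i = h (coeff p i)"
  by (simp add: coeff_map_poly hom_zero)

lemma map_hom_pCons: "map_poly h (pCons c p) = pCons (h c) (map_poly h p)"
  by (rule map_poly_pCons) (rule hom_zero)

lemma map_hom_add:
  "p \<in> polys_over K \<Longrightarrow> q \<in> polys_over K \<Longrightarrow> map_poly h (p + q) = map_poly h p + map_poly h q"
  by (intro poly_eqI) (simp add: polys_over_def hom_add)

lemma map_hom_mult:
  "p \<in> polys_over K \<Longrightarrow> q \<in> polys_over K \<Longrightarrow> map_poly h (p * q) = map_poly h p * map_poly h q"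
  by (intro poly_eqI) (simp add: polys_over_def coeff_mult hom_sum mult_mem hom_mult)

lemma map_hom_pderiv: "p \<in> polys_over K \<Longrightarrow> map_poly h (pderiv p) = pderiv (map_poly h p)"
  by (intro poly_eqI) (simp add: coeff_pderiv polys_over_def hom_mult hom_of_nat of_nat_mem del: of_nat_Suc)

lemma map_hom_pcompose:
  assumes "p \<in> polys_over K" "q \<in> polys_over K"
  shows "map_poly h (pcompose p q) = pcompose (map_poly h p) (map_poly h q)"
  using assms(1)
proof (induction p)
  case (pCons c p)
  note mem = pCons_overD[OF pCons.prems]
  have "map_poly h [:c:] = [:h c:]" by (simp add: map_hom_pCons)
  then show ?case
    using mem assms(2) pCons.IH
    by (simp add: pcompose_pCons map_hom_pCons map_hom_add map_hom_mult const_over mult_over pcompose_over)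
qed simp

lemma poly_map_hom:
  assumes "p \<in> polys_over K" "x \<in> K"
  shows "poly (map_poly h p) (h x) = h (poly p x)"
  using assms(1)
proof (induction p)
  case (pCons c p)
  then show ?case
    using pCons_overD[of c p] assms(2)
    by (simp add: map_hom_pCons hom_add hom_mult mult_mem poly_mem)
qed (simp add: hom_zero)

end

section \<open>Rational and algebraic numbers as coefficient rings\<close>

interpretation Rats_subring: subring_set "\<rat> :: 'a::field_char_0 set"
  by unfold_locales auto

interpretation Qbar_subring: subring_set Qbar
  by unfold_locales (auto simp: Qbar_def algebraic_add_complex algebraic_mult_complex)

interpretation of_rat_hom: subring_hom UNIV "of_rat :: rat \<Rightarrow> 'a::field_char_0"
  by unfold_locales (auto simp: of_rat_add of_rat_mult)

lemma Rats_subset_Qbar: "\<rat> \<subseteq> Qbar"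
  by (auto simp: Qbar_def rat_imp_algebraic)

lemma Rats_over_Qbar: "p \<in> polys_over \<rat> \<Longrightarrow> p \<in> polys_over Qbar"
  using Rats_subset_Qbar by (auto simp: polys_over_def)

lemma Qbar_root:
  "p \<in> polys_over Qbar \<Longrightarrow> p \<noteq> 0 \<Longrightarrow> poly p z = 0 \<Longrightarrow> z \<in> Qbar"
  unfolding polys_over_def Qbar_def mem_Collect_eq by (rule algebraic_root_of_algebraic_poly) auto

lemma Qbar_preimage:
  assumes "p \<in> polys_over Qbar" "degree p > 0" "poly p z \<in> Qbar"
  shows "z \<in> Qbar"
proof (rule Qbar_root)
  show "p - [:poly p z:] \<in> polys_over Qbar"
    using assms by (intro Qbar_subring.diff_over Qbar_subring.const_over)
  show "p - [:poly p z:] \<noteq> 0"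
    using assms(2) by (metis degree_pCons_0 eq_iff_diff_eq_0 less_irrefl)
qed simp

section \<open>Belyi's theorem for polynomials\<close>

lemma pcompose_power: "pcompose (p ^ n) q = pcompose p q ^ n"
  by (induction n) (simp_all add: pcompose_mult pcompose_1)

lemma pcompose_monom: "pcompose (monom c n) q = smult c (q ^ n)"
  by (simp add: monom_altdef pcompose_smult pcompose_power pcompose_pCons)

interpretation rat_poly: vector_space "smult :: rat \<Rightarrow> rat poly \<Rightarrow> rat poly"
  by unfold_locales (simp_all add: smult_add_right smult_add_left)

lemma rat_poly_in_span_monoms:
  fixes p :: "rat poly"
  assumes "p = 0 \<or> degree p < n"
  shows "p \<in> rat_poly.span (monom 1 ` {..<n})"
proof -
  have "p = (\<Sum>i<n. smult (coeff p i) (monom 1 i))"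
  proof (rule poly_eqI)
    show "coeff p k = coeff (\<Sum>i<n. smult (coeff p i) (monom 1 i)) k" for k
      using assms by (auto simp: coeff_sum smult_monom coeff_eq_0)
  qed
  also have "\<dots> \<in> rat_poly.span (monom 1 ` {..<n})"
    by (intro rat_poly.span_sum rat_poly.span_scale rat_poly.span_base imageI)
  finally show ?thesis .
qed

text \<open>Powers of \<open>m\<close> modulo \<open>u\<close> lie in a space of dimension at most
  \<open>degree u\<close>; the coefficients of a linear relation between them form \<open>T\<close>.
  The bound on its degree is what later makes an induction descend.\<close>

lemma rat_poly_image_annihilator:
  fixes m u :: "rat poly"
  assumes "u \<noteq> 0"
  shows "\<exists>T. T \<noteq> 0 \<and> degree T \<le> degree u \<and> u dvd pcompose T m"
proof -
  define M :: "rat poly set" where "M = monom 1 ` {..<degree u}"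
  have fin: "finite M" by (simp add: M_def)
  have cM: "card M \<le> degree u"
    unfolding M_def by (rule order_trans[OF card_image_le]) simp_all
  have "m ^ i mod u \<in> rat_poly.span M" for i
    unfolding M_def using assms degree_mod_less by (intro rat_poly_in_span_monoms) blast
  from rat_poly.dependent_family[of M "\<lambda>i. m ^ i mod u", OF fin this]
  obtain a k where a: "k \<le> card M" "a k \<noteq> 0"
    "(\<Sum>i\<le>card M. smult (a i) (m ^ i mod u)) = 0"
    by (elim exE conjE)
  define T where "T = (\<Sum>i\<le>card M. monom (a i) i)"
  have "coeff T k = a k" using a(1) by (simp add: T_def coeff_sum)
  then have "T \<noteq> 0" using a(2) by auto
  moreover have "degree T \<le> card M"
    unfolding T_def by (intro degree_sum_le) (auto intro: order_trans[OF degree_monom_le])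
  moreover have "u dvd pcompose T m"
  proof -
    \<comment> \<open>The subtracted sum is the relation, hence 0; it pairs each power with its
      remainder, leaving multiples of \<open>u\<close>.\<close>
    have "pcompose T m = (\<Sum>i\<le>card M. smult (a i) (m ^ i)) - (\<Sum>i\<le>card M. smult (a i) (m ^ i mod u))"
      unfolding a(3) by (simp add: T_def pcompose_sum pcompose_monom)
    also have "\<dots> = (\<Sum>i\<le>card M. smult (a i) (m ^ i - m ^ i mod u))"
      by (simp add: sum_subtractf smult_diff_right)
    also have "u dvd \<dots>"
      by (intro dvd_sum dvd_smult dvd_minus_mod)
    finally show ?thesis .
  qed
  ultimately show ?thesis using cM by (intro exI[of _ T]) auto
qed

text \<open>The relation is found over the type \<open>rat\<close> and carried back by
  \<open>of_rat\<close>; divisibility by \<open>u\<close> becomes vanishing of \<open>T\<close> at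
  the images of the roots of \<open>u\<close>.\<close>

lemma Rats_poly_image_annihilator:
  fixes m u :: "complex poly"
  assumes "m \<in> polys_over \<rat>" "u \<in> polys_over \<rat>" "u \<noteq> 0"
  shows "\<exists>T\<in>polys_over \<rat>. T \<noteq> 0 \<and> degree T \<le> degree u \<and>
    (\<forall>c. poly u c = 0 \<longrightarrow> poly T (poly m c) = 0)"
proof -
  let ?r = "map_poly of_rat :: rat poly \<Rightarrow> complex poly"
  have deg: "degree (?r p) = degree p" for p
    by (rule degree_map_poly) simp
  have over: "p \<in> polys_over UNIV" for p :: "rat poly" by (simp add: polys_over_def)
  obtain m' where m': "m = ?r m'"
    using assms(1) ratpolyE[of m] by (auto simp: polys_over_def)
  obtain u' where u': "u = ?r u'"
    using assms(2) ratpolyE[of u] by (auto simp: polys_over_def)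
  have "u' \<noteq> 0" using assms(3) u' by auto
  then obtain T where T: "T \<noteq> 0" "degree T \<le> degree u'" "u' dvd pcompose T m'"
    using rat_poly_image_annihilator by blast
  then obtain v where v: "pcompose T m' = u' * v" by (auto elim: dvdE)
  have eq: "pcompose (?r T) m = u * ?r v"
    using of_rat_hom.map_hom_pcompose[OF over over, of T m', where ?'a = complex]
      of_rat_hom.map_hom_mult[OF over over, of u' v, where ?'a = complex] v m' u' by simp
  have "poly (?r T) (poly m c) = 0" if "poly u c = 0" for c
    using arg_cong[OF eq, of "\<lambda>p. poly p c"] that by (simp add: poly_pcompose)
  moreover have "?r T \<noteq> 0" using T(1) deg[of T]
    by (metis coeff_map_poly leading_coeff_0_iff of_rat_0 of_rat_eq_0_iff coeff_0)
  moreover have "?r T \<in> polys_over \<rat>" by (simp add: polys_over_def coeff_map_poly)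
  ultimately show ?thesis using T(2) deg u' by (intro bexI[of _ "?r T"]) auto
qed

section \<open>Critical values of composites and how to make them rational\<close>

lemma finite_critical_points: "degree f > 0 \<Longrightarrow> finite (critical_points f)"
  unfolding critical_points_def by (rule poly_roots_finite) (simp add: pderiv_eq_0_iff)

lemma critical_values_linear: "b \<noteq> 0 \<Longrightarrow> critical_values [:a, b:] = {}"
  by (simp add: critical_values_def critical_points_def pderiv_pCons)

lemma critical_values_pcompose:
  "critical_values (pcompose f g) \<subseteq> critical_values f \<union> poly f ` critical_values g"
  by (auto simp: critical_values_def critical_points_def pderiv_pcompose poly_pcompose)

text \<open>
  Since \<open>m\<close> maps all its roots to 0, only the critical values of \<open>m\<close> remain to be made rational. They
  are roots of a rational polynomial of degree at most that of \<open>m'\<close>, so induction on the degree applies.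
\<close>

lemma rational_critical_values:
  assumes "m \<in> polys_over \<rat>" "m \<noteq> 0" "degree m \<le> d"
  shows "\<exists>B\<in>polys_over \<rat>. degree B > 0 \<and> critical_values B \<subseteq> \<rat> \<and>
    (\<forall>z. poly m z = 0 \<longrightarrow> poly B z \<in> \<rat>)"
  using assms
proof (induction d arbitrary: m)
  case 0
  \<comment> \<open>A nonzero constant has no roots, so the identity polynomial serves.\<close>
  then obtain c where "m = [:c:]" by (metis degree_eq_zeroE le_zero_eq)
  then have "\<forall>z. poly m z \<noteq> 0" using "0.prems" by auto
  moreover have "[:0, 1:] \<in> polys_over (\<rat> :: complex set)"
    by (intro Rats_subring.pCons_over Rats_subring.zero_over) auto
  moreover have "critical_values [:0, 1:] = {}" by (rule critical_values_linear) simp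
  ultimately show ?case by (intro bexI[of _ "[:0, 1:]"]) auto
next
  case (Suc d)
  show ?case
  proof (cases "degree m \<le> d")
    case True
    with Suc show ?thesis by blast
  next
    case False
    with Suc.prems have deg: "degree m = Suc d" by simp
    have "pderiv m \<noteq> 0" using deg by (simp add: pderiv_eq_0_iff)
    moreover have "degree (pderiv m) = d" using deg by (simp add: degree_pderiv)
    ultimately obtain T where T: "T \<in> polys_over \<rat>" "T \<noteq> 0" "degree T \<le> d"
      "\<And>c. poly (pderiv m) c = 0 \<Longrightarrow> poly T (poly m c) = 0"
      using Rats_poly_image_annihilator[OF Suc.prems(1) Rats_subring.pderiv_over[OF Suc.prems(1)]]
      by auto
    obtain B1 where B1: "B1 \<in> polys_over \<rat>" "degree B1 > 0" "critical_values B1 \<subseteq> \<rat>"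
      "\<And>z. poly T z = 0 \<Longrightarrow> poly B1 z \<in> \<rat>"
      using Suc.IH[OF T(1-3)] by blast
    have "poly B1 ` critical_values m \<subseteq> \<rat>"
      using T(4) B1(4) by (auto simp: critical_values_def critical_points_def)
    then have "critical_values (pcompose B1 m) \<subseteq> \<rat>"
      using critical_values_pcompose[of B1 m] B1(3) by blast
    moreover have "pcompose B1 m \<in> polys_over \<rat>"
      using B1(1) Suc.prems(1) by (rule Rats_subring.pcompose_over)
    moreover have "degree (pcompose B1 m) > 0"
      using B1(2) deg by (simp add: degree_pcompose)
    \<comment> \<open>All roots of \<open>m\<close> go to the value of \<open>B1\<close> at 0, which
      is rational.\<close>
    moreover have "poly (pcompose B1 m) z \<in> \<rat>" if "poly m z = 0" for z
      using that Rats_subring.poly_mem[OF B1(1), of 0] by (simp add: poly_pcompose)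
    ultimately show ?thesis by blast
  qed
qed

section \<open>Reducing critical values and finitely many points to 0 and 1\<close>

lemma Qbar_finite_annihilator:
  assumes "finite S" "S \<subseteq> Qbar"
  shows "\<exists>m\<in>polys_over \<rat>. m \<noteq> 0 \<and> (\<forall>s\<in>S. poly m s = 0)"
  using assms
proof (induction rule: finite_induct)
  case empty
  show ?case by (intro bexI[of _ 1] Rats_subring.one_over) auto
next
  case (insert s S)
  then obtain m where m: "m \<in> polys_over \<rat>" "m \<noteq> 0" "\<forall>s\<in>S. poly m s = 0" by auto
  obtain p where p: "p \<in> polys_over \<rat>" "p \<noteq> 0" "poly p s = 0"
    using insert.prems by (auto simp: Qbar_def algebraic_altdef polys_over_def)
  from m p show ?case
    by (intro bexI[of _ "m * p"] Rats_subring.mult_over) auto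
qed

text \<open>Outside 0 and 1, the derivative of z^(a+1) (1 - z)^(b+1) vanishes only at
  \<open>r\<close>. Exponents written as successors make 0 and 1 roots, and the scaling factor makes
  the value at \<open>r\<close> equal to 1.\<close>

lemma belyi_shabat_polynomial:
  fixes r :: complex
  assumes r: "r = of_nat (Suc a) / of_nat (Suc a + Suc b)"
  shows "\<exists>\<beta>\<in>polys_over \<rat>. degree \<beta> > 0 \<and> critical_values \<beta> \<subseteq> {0, 1} \<and>
    poly \<beta> 0 = 0 \<and> poly \<beta> 1 = 0 \<and> poly \<beta> r = 1"
proof -
  let ?c = "inverse (r ^ Suc a * (1 - r) ^ Suc b)"
  define \<beta> where "\<beta> = smult ?c ([:0, 1:] ^ Suc a * [:1, -1:] ^ Suc b)"
  have nz: "(of_nat (Suc a + Suc b) :: complex) \<noteq> 0" by (simp only: of_nat_eq_0_iff)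
  have r0: "r \<noteq> 0" using nz unfolding r by (simp del: of_nat_Suc of_nat_add)
  have "1 - r = of_nat (Suc b) / of_nat (Suc a + Suc b)"
    using nz unfolding r by (simp add: field_simps)
  then have r1: "1 - r \<noteq> 0" using nz by (simp del: of_nat_Suc of_nat_add)
  have c0: "?c \<noteq> 0" using r0 r1 by simp
  have rQ: "r \<in> \<rat>" unfolding r by (intro Rats_divide Rats_of_nat)
  have "\<beta> \<in> polys_over \<rat>"
    unfolding \<beta>_def using rQ
    by (intro Rats_subring.smult_over Rats_subring.mult_over Rats_subring.power_over
        Rats_subring.pCons_over Rats_subring.zero_over Rats_inverse Rats_mult Rats_power Rats_diff) auto
  moreover have "degree \<beta> > 0"
    unfolding \<beta>_def using c0 by (simp add: degree_mult_eq degree_power_eq del: power_Suc)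
  moreover have v: "poly \<beta> 0 = 0" "poly \<beta> 1 = 0" by (simp_all add: \<beta>_def)
  moreover have vr: "poly \<beta> r = 1"
  proof -
    have "r ^ Suc a * (1 - r) ^ Suc b \<noteq> 0" using r0 r1 by simp
    note inv = left_inverse[OF this]
    have "poly ([:0, 1:] ^ Suc a * [:1, -1:] ^ Suc b) r = r ^ Suc a * (1 - r) ^ Suc b"
      by (simp del: power_Suc)
    then show ?thesis unfolding \<beta>_def poly_smult by (simp only: inv)
  qed
  moreover have "poly \<beta> z \<in> {0, 1}" if z: "poly (pderiv \<beta>) z = 0" for z
  proof -
    have "pderiv \<beta> = smult ?c ([:0, 1:] ^ Suc a * (smult (of_nat (Suc b)) ([:1, -1:] ^ b) * pderiv [:1, -1:])
        + [:1, -1:] ^ Suc b * (smult (of_nat (Suc a)) ([:0, 1:] ^ a) * pderiv [:0, 1:]))"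
      by (simp only: \<beta>_def pderiv_smult pderiv_mult pderiv_power_Suc)
    then have "poly (pderiv \<beta>) z = ?c * (z ^ Suc a * (of_nat (Suc b) * (1 - z) ^ b * (- 1)) +
        (1 - z) ^ Suc b * (of_nat (Suc a) * z ^ a))"
      by (simp only: poly_smult poly_mult poly_add poly_power) (simp add: pderiv_pCons del: power_Suc of_nat_Suc)
    also have "z ^ Suc a * (of_nat (Suc b) * (1 - z) ^ b * (- 1)) + (1 - z) ^ Suc b * (of_nat (Suc a) * z ^ a) =
        z ^ a * (1 - z) ^ b * (of_nat (Suc a) * (1 - z) - of_nat (Suc b) * z)"
      by (simp add: algebra_simps del: of_nat_Suc)
    finally have "poly (pderiv \<beta>) z = ?c * (z ^ a * (1 - z) ^ b *
        (of_nat (Suc a) * (1 - z) - of_nat (Suc b) * z))" .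
    with z c0 have "z ^ a * (1 - z) ^ b * (of_nat (Suc a) * (1 - z) - of_nat (Suc b) * z) = 0"
      by simp
    then have "z = 0 \<or> z = 1 \<or> of_nat (Suc a) * (1 - z) = of_nat (Suc b) * z"
      by (auto simp del: of_nat_Suc)
    moreover have "z = r" if "of_nat (Suc a) * (1 - z) = of_nat (Suc b) * z"
    proof -
      have "z * of_nat (Suc a + Suc b) = of_nat (Suc a)"
        using that by (simp add: algebra_simps)
      then show ?thesis unfolding r by (metis nz nonzero_eq_divide_eq)
    qed
    ultimately show ?thesis using v vr by auto
  qed
  ultimately show ?thesis
    by (intro bexI[of _ \<beta>]) (auto simp: critical_values_def critical_points_def)
qed

text \<open>
  For three points \<open>s < x < t\<close> of \<open>S\<close>, moved to \<open>0 < r < 1\<close>, the Shabat polynomial at \<open>r\<close> identifies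
  \<open>s\<close> and \<open>t\<close> and has its critical values in the image of \<open>S\<close>, which is smaller than \<open>S\<close>.
\<close>

lemma belyi_rational:
  assumes "finite S" "S \<subseteq> \<rat>"
  shows "\<exists>B\<in>polys_over \<rat>. degree B > 0 \<and> critical_values B \<subseteq> {0, 1 :: complex} \<and> poly B ` S \<subseteq> {0, 1}"
  using assms
proof (induction "card S" arbitrary: S rule: less_induct)
  case less
  define S0 :: "rat set" where "S0 = {q. of_rat q \<in> S}"
  have S: "S = of_rat ` S0"
    using less.prems(2) by (auto simp: S0_def elim!: Rats_cases)
  have inj: "inj_on (of_rat :: rat \<Rightarrow> complex) S0" by (simp add: inj_on_def)
  have fin0: "finite S0" and card0: "card S = card S0"
    using less.prems(1) finite_image_iff[OF inj] card_image[OF inj] by (auto simp: S)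
  \<comment> \<open>These are the coefficients of x |-> (x - s) / (t - s), which takes
    \<open>s\<close> to 0 and \<open>t\<close> to 1 when they differ.\<close>
  have linear: "[:of_rat (- s / (t - s)), of_rat (1 / (t - s)):] \<in> polys_over (\<rat> :: complex set)"
      for s t
    by (intro Rats_subring.pCons_over Rats_subring.zero_over Rats_of_rat)
  have eval: "poly [:of_rat (- s / (t - s)), of_rat (1 / (t - s)):] (of_rat x :: complex)
      = of_rat ((x - s) / (t - s))" for s t x
    by (simp add: of_rat_divide of_rat_minus of_rat_diff diff_divide_distrib)
  show ?case
  proof (cases "card S0 \<le> 2")
    case True
    \<comment> \<open>At most two points can be moved to 0 and 1 by an affine map; if a point is
      missing, any other one completes the pair.\<close>
    have "\<exists>s t. s \<noteq> t \<and> S0 \<subseteq> {s, t}"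
    proof -
      consider "card S0 = 0" | "card S0 = 1" | "card S0 = 2" using True by linarith
      then show ?thesis
      proof cases
        case 1
        then have "S0 = {}" using fin0 by simp
        then show ?thesis by (metis empty_subsetI zero_neq_one)
      next
        case 2
        then obtain s where "S0 = {s}" by (auto simp: card_1_singleton_iff)
        then have "s \<noteq> s + 1 \<and> S0 \<subseteq> {s, s + 1}" by simp
        then show ?thesis by blast
      next
        case 3
        then show ?thesis by (auto simp: card_2_iff)
      qed
    qed
    then obtain s t where st: "s \<noteq> t" "S0 \<subseteq> {s, t}" by blast
    let ?L = "[:of_rat (- s / (t - s)), of_rat (1 / (t - s)):] :: complex poly"
    have "poly ?L ` S \<subseteq> {0, 1}"
      using st unfolding S image_image eval by auto
    moreover have "critical_values ?L = {}" "degree ?L > 0"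
      using st by (simp_all add: critical_values_linear)
    ultimately show ?thesis using linear by (intro bexI[of _ ?L]) auto
  next
    case False
    define s where "s = Min S0"
    define t where "t = Max S0"
    have ne: "S0 \<noteq> {}" using False by auto
    have mem: "s \<in> S0" "t \<in> S0" using fin0 ne by (simp_all add: s_def t_def)
    have "\<not> S0 \<subseteq> {s, t}"
    proof
      assume "S0 \<subseteq> {s, t}"
      then have "card S0 \<le> card {s, t}" by (intro card_mono) auto
      also have "\<dots> \<le> 2" by (simp add: card_insert_if)
      finally show False using False by simp
    qed
    then obtain x where x: "x \<in> S0" "x \<noteq> s" "x \<noteq> t" by auto
    have "s \<le> x" "x \<le> t" using fin0 x(1) by (simp_all add: s_def t_def)
    with x have sxt: "s < x" "x < t" by auto
    define r where "r = (x - s) / (t - s)"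
    have r: "0 < r" "r < 1" using sxt by (simp_all add: r_def)
    obtain n d where nd: "r = Fract n d" "d > 0" by (cases r) auto
    have "0 < n" "n < d" using r nd by (simp_all add: zero_less_Fract_iff Fract_less_one_iff)
    \<comment> \<open>Both \<open>n\<close> and \<open>d - n\<close> are positive, so subtracting 1
      writes them as the successors that serve as exponents of the Shabat polynomial.\<close>
    define a where "a = nat n - 1"
    define b where "b = nat (d - n) - 1"
    have "n = int (Suc a)" "d = int (Suc a + Suc b)"
      using \<open>0 < n\<close> \<open>n < d\<close> by (simp_all add: a_def b_def)
    then have "(of_int n :: complex) = of_nat (Suc a)" "(of_int d :: complex) = of_nat (Suc a + Suc b)"
      by (simp_all only: of_int_of_nat_eq)
    moreover have "(of_rat r :: complex) = of_int n / of_int d"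
      using nd by (simp add: of_rat_rat)
    ultimately have "(of_rat r :: complex) = of_nat (Suc a) / of_nat (Suc a + Suc b)" by simp
    from belyi_shabat_polynomial[OF this] obtain \<beta> where \<beta>:
      "\<beta> \<in> polys_over \<rat>" "degree \<beta> > 0" "critical_values \<beta> \<subseteq> {0, 1}"
      "poly \<beta> 0 = 0" "poly \<beta> 1 = 0" "poly \<beta> (of_rat r) = 1" by blast
    let ?L = "[:of_rat (- s / (t - s)), of_rat (1 / (t - s)):] :: complex poly"
    define f where "f = pcompose \<beta> ?L"
    have fe: "poly f (of_rat y) = poly \<beta> (of_rat ((y - s) / (t - s)))" for y
      unfolding f_def poly_pcompose eval ..
    have fs: "poly f (of_rat s) = 0" and ft: "poly f (of_rat t) = 0" and fx: "poly f (of_rat x) = 1"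
      using sxt \<beta>(4-6) by (simp_all add: fe r_def)
    have f_over: "f \<in> polys_over \<rat>"
      unfolding f_def by (intro Rats_subring.pcompose_over \<beta>(1) linear)
    have f_deg: "degree f > 0"
      using \<beta>(2) sxt by (simp add: f_def degree_pcompose)
    have "critical_values ?L = {}" using sxt by (intro critical_values_linear) simp
    then have f_crit: "critical_values f \<subseteq> {0, 1}"
      using critical_values_pcompose[of \<beta> ?L] \<beta>(3) by (auto simp: f_def)
    let ?S' = "poly f ` S"
    \<comment> \<open>\<open>s\<close> and \<open>t\<close> have the same image 0, so dropping
      \<open>t\<close> does not change the image; this makes the induction on the cardinality go
      down.\<close>
    have "?S' = poly f ` (S - {of_rat t})"
    proof
      show "?S' \<subseteq> poly f ` (S - {of_rat t})"
      proof
        fix v assume "v \<in> ?S'"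
        then obtain y where y: "y \<in> S" "v = poly f y" by blast
        show "v \<in> poly f ` (S - {of_rat t})"
        proof (cases "y = of_rat t")
          case True
          then have "v = poly f (of_rat s)" using y fs ft by simp
          moreover have "of_rat s \<in> S - {of_rat t}" using mem sxt by (simp add: S)
          ultimately show ?thesis by blast
        qed (use y in auto)
      qed
    qed auto
    then have "card ?S' \<le> card (S - {of_rat t})"
      using less.prems(1) by (simp add: card_image_le)
    also have "\<dots> < card S"
      using less.prems(1) mem by (intro card_Diff1_less) (auto simp: S)
    finally have "card ?S' < card S" .
    moreover have "?S' \<subseteq> \<rat>"
      using less.prems(2) by (auto intro: Rats_subring.poly_mem[OF f_over])
    ultimately obtain B where B: "B \<in> polys_over \<rat>" "degree B > 0"
      "critical_values B \<subseteq> {0, 1}" "poly B ` ?S' \<subseteq> {0, 1}"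
      using less.hyps[of ?S'] finite_imageI[OF less.prems(1)] by meson
    \<comment> \<open>The images of \<open>s\<close> and \<open>x\<close> are 0 and 1, so the
      critical values of \<open>f\<close> are among the points that \<open>B\<close> sends into {0,
      1}.\<close>
    have "0 \<in> ?S'" "1 \<in> ?S'"
      using imageI[of "of_rat s" S "poly f"] imageI[of "of_rat x" S "poly f"] mem x fs fx
      by (simp_all add: S)
    then have "{0, 1} \<subseteq> ?S'" by simp
    then have "poly B ` critical_values f \<subseteq> poly B ` ?S'"
      using f_crit by (intro image_mono) (rule order_trans)
    then have "critical_values B \<union> poly B ` critical_values f \<subseteq> {0, 1}"
      using B(3,4) by (intro Un_least) (assumption, rule order_trans)
    with critical_values_pcompose[of B f] have "critical_values (pcompose B f) \<subseteq> {0, 1}"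
      by (rule order_trans)
    moreover have "poly (pcompose B f) ` S \<subseteq> {0, 1}"
      using B(4) by (auto simp: poly_pcompose)
    moreover have "pcompose B f \<in> polys_over \<rat>"
      by (intro Rats_subring.pcompose_over B f_over)
    moreover have "degree (pcompose B f) > 0"
      using B(2) f_deg by (simp add: degree_pcompose)
    ultimately show ?thesis by (intro bexI[of _ "pcompose B f"]) simp_all
  qed
qed

text \<open>Two stages: \<open>f\<close> makes its critical values and the image of \<open>S\<close>
  rational, then \<open>B\<close> sends these finitely many rationals to 0 and 1. By the chain rule
  the composite acquires no other critical values.\<close>

lemma belyi:
  assumes "finite S" "S \<subseteq> Qbar"
  shows "\<exists>B\<in>polys_over \<rat>. degree B > 0 \<and> critical_values B \<subseteq> {0, 1} \<and> poly B ` S \<subseteq> {0, 1}"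
proof -
  obtain m where m: "m \<in> polys_over \<rat>" "m \<noteq> 0" "\<forall>s\<in>S. poly m s = 0"
    using Qbar_finite_annihilator[OF assms] by blast
  then obtain f where f: "f \<in> polys_over \<rat>" "degree f > 0" "critical_values f \<subseteq> \<rat>"
    "\<forall>z. poly m z = 0 \<longrightarrow> poly f z \<in> \<rat>"
    using rational_critical_values[OF m(1,2) order_refl] by blast
  let ?S' = "critical_values f \<union> poly f ` S"
  have "finite ?S'"
    using assms(1) finite_critical_points[OF f(2)] by (simp add: critical_values_def)
  moreover have "?S' \<subseteq> \<rat>" using f(3,4) m(3) by blast
  ultimately obtain B where B: "B \<in> polys_over \<rat>" "degree B > 0"
    "critical_values B \<subseteq> {0, 1}" "poly B ` ?S' \<subseteq> {0, 1}"
    using belyi_rational[of ?S'] by meson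
  have "critical_values (pcompose B f) \<subseteq> {0, 1}"
    using critical_values_pcompose[of B f] B(3,4) by blast
  moreover have "poly (pcompose B f) ` S \<subseteq> {0, 1}"
    using B(4) by (auto simp: poly_pcompose)
  moreover have "pcompose B f \<in> polys_over \<rat>"
    by (intro Rats_subring.pcompose_over B f)
  moreover have "degree (pcompose B f) > 0"
    using B(2) f(2) by (simp add: degree_pcompose)
  ultimately show ?thesis by blast
qed

section \<open>The action of the Galois group\<close>

abbreviation galois_auts :: "(complex \<Rightarrow> complex) set"
  where "galois_auts \<equiv> carrier absolute_galois_group"

lemma galois_auts_iff:
  "\<sigma> \<in> galois_auts \<longleftrightarrow> \<sigma> \<in> Bij Qbar \<and>
     (\<forall>x\<in>Qbar. \<forall>y\<in>Qbar. \<sigma> (x + y) = \<sigma> x + \<sigma> y) \<and>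
     (\<forall>x\<in>Qbar. \<forall>y\<in>Qbar. \<sigma> (x * y) = \<sigma> x * \<sigma> y) \<and>
     (\<forall>q\<in>\<rat>. \<sigma> q = q)"
  by (simp add: absolute_galois_group_def)

lemma subgroup_galois_auts: "subgroup galois_auts (BijGroup Qbar)"
proof (rule group.subgroupI[OF group_BijGroup])
  show "galois_auts \<subseteq> carrier (BijGroup Qbar)"
    by (auto simp: galois_auts_iff BijGroup_def)
  have "(\<lambda>x\<in>Qbar. x) \<in> galois_auts"
    using Rats_subset_Qbar
    by (auto simp: galois_auts_iff id_Bij Qbar_subring.add_mem Qbar_subring.mult_mem)
  then show "galois_auts \<noteq> {}" by blast
next
  fix \<sigma> assume s: "\<sigma> \<in> galois_auts"
  then have B: "\<sigma> \<in> Bij Qbar" and bij: "bij_betw \<sigma> Qbar Qbar"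
    by (auto simp: galois_auts_iff Bij_def)
  let ?t = "\<lambda>x\<in>Qbar. inv_into Qbar \<sigma> x"
  have st: "\<sigma> (?t x) = x" "?t x \<in> Qbar" if "x \<in> Qbar" for x
    using that bij by (auto simp: bij_betw_def f_inv_into_f inv_into_into)
  have ts: "?t (\<sigma> x) = x" if "x \<in> Qbar" for x
    using that bij by (auto simp: bij_betw_def)
  have "?t (x + y) = ?t x + ?t y" if "x \<in> Qbar" "y \<in> Qbar" for x y
  proof -
    have "\<sigma> (?t x + ?t y) = x + y"
      using s st[OF that(1)] st[OF that(2)] unfolding galois_auts_iff by metis
    then show ?thesis
      using ts[of "?t x + ?t y"] Qbar_subring.add_mem[OF st(2)[OF that(1)] st(2)[OF that(2)]] by metis
  qed
  moreover have "?t (x * y) = ?t x * ?t y" if "x \<in> Qbar" "y \<in> Qbar" for x y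
  proof -
    have "\<sigma> (?t x * ?t y) = x * y"
      using s st[OF that(1)] st[OF that(2)] unfolding galois_auts_iff by metis
    then show ?thesis
      using ts[of "?t x * ?t y"] Qbar_subring.mult_mem[OF st(2)[OF that(1)] st(2)[OF that(2)]] by metis
  qed
  moreover have "?t q = q" if "q \<in> \<rat>" for q
    using ts[of q] s that Rats_subset_Qbar unfolding galois_auts_iff by (metis subsetD)
  ultimately have "?t \<in> galois_auts"
    unfolding galois_auts_iff using restrict_inv_into_Bij[OF B] by blast
  then show "inv\<^bsub>BijGroup Qbar\<^esub> \<sigma> \<in> galois_auts"
    using inv_BijGroup[OF B] by simp
next
  fix \<sigma> \<tau> assume s: "\<sigma> \<in> galois_auts" and t: "\<tau> \<in> galois_auts"
  then have B: "\<sigma> \<in> Bij Qbar" "\<tau> \<in> Bij Qbar" by (auto simp: galois_auts_iff)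
  then have mem: "x \<in> Qbar \<Longrightarrow> \<tau> x \<in> Qbar" for x by (auto simp: Bij_def bij_betw_def)
  have "compose Qbar \<sigma> \<tau> \<in> galois_auts"
    using s t mem compose_Bij[OF B] Rats_subset_Qbar
    by (auto simp: galois_auts_iff compose_def Qbar_subring.add_mem Qbar_subring.mult_mem subset_iff)
  then show "\<sigma> \<otimes>\<^bsub>BijGroup Qbar\<^esub> \<tau> \<in> galois_auts"
    using B by (simp add: BijGroup_def)
qed

lemma group_absolute_galois_group: "group absolute_galois_group"
  using subgroup.subgroup_is_group[OF subgroup_galois_auts group_BijGroup]
  by (simp add: absolute_galois_group_def)

locale galois_aut =
  fixes \<sigma> :: "complex \<Rightarrow> complex"
  assumes aut: "\<sigma> \<in> galois_auts"
begin

lemma bij: "bij_betw \<sigma> Qbar Qbar"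
  using aut by (simp add: galois_auts_iff Bij_def)

lemma fix_Rats: "q \<in> \<rat> \<Longrightarrow> \<sigma> q = q"
  using aut by (simp add: galois_auts_iff)

sublocale subring_hom Qbar \<sigma>
proof unfold_locales
  show "\<sigma> 1 = 1" by (rule fix_Rats) simp
qed (use aut in \<open>simp_all add: galois_auts_iff\<close>)

lemma image_mem: "x \<in> Qbar \<Longrightarrow> \<sigma> x \<in> Qbar"
  using bij by (auto simp: bij_betw_def)

lemma eq_iff: "x \<in> Qbar \<Longrightarrow> y \<in> Qbar \<Longrightarrow> \<sigma> x = \<sigma> y \<longleftrightarrow> x = y"
  using bij by (auto simp: bij_betw_def inj_on_def)

lemma eq_0_iff: "x \<in> Qbar \<Longrightarrow> \<sigma> x = 0 \<longleftrightarrow> x = 0"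
  using eq_iff[OF _ Qbar_subring.zero_mem] hom_zero by simp

lemma eq_1_iff: "x \<in> Qbar \<Longrightarrow> \<sigma> x = 1 \<longleftrightarrow> x = 1"
  using eq_iff[OF _ Qbar_subring.one_mem] hom_one by simp

lemma preimage: "y \<in> Qbar \<Longrightarrow> \<exists>x\<in>Qbar. y = \<sigma> x"
  using bij by (auto simp: bij_betw_def)

lemma coeff_twist: "coeff (twist \<sigma> f) i = \<sigma> (coeff f i)"
  by (simp add: twist_def)

lemma twist_over: "f \<in> polys_over Qbar \<Longrightarrow> twist \<sigma> f \<in> polys_over Qbar"
  by (simp add: polys_over_def coeff_twist image_mem)

lemma degree_twist:
  assumes "f \<in> polys_over Qbar"
  shows "degree (twist \<sigma> f) = degree f"
proof (cases "f = 0")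
  case False
  have "degree f \<le> degree (twist \<sigma> f)"
    using False assms by (intro le_degree) (simp add: coeff_twist polys_over_def eq_0_iff)
  moreover have "degree (twist \<sigma> f) \<le> degree f"
    by (rule degree_le) (simp add: coeff_twist coeff_eq_0 hom_zero)
  ultimately show ?thesis by simp
qed (simp add: twist_def)

lemma poly_twist: "f \<in> polys_over Qbar \<Longrightarrow> x \<in> Qbar \<Longrightarrow> poly (twist \<sigma> f) (\<sigma> x) = \<sigma> (poly f x)"
  unfolding twist_def by (rule poly_map_hom)

lemma pderiv_twist: "f \<in> polys_over Qbar \<Longrightarrow> pderiv (twist \<sigma> f) = twist \<sigma> (pderiv f)"
  unfolding twist_def by (rule map_hom_pderiv[symmetric])

lemma twist_Rats:
  assumes "f \<in> polys_over \<rat>"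
  shows "twist \<sigma> f = f"
  by (rule poly_eqI) (use assms in \<open>simp add: coeff_twist fix_Rats polys_over_def\<close>)

lemma funpow_poly_twist:
  assumes "f \<in> polys_over Qbar" "x \<in> Qbar"
  shows "(poly f ^^ n) x \<in> Qbar \<and> (poly (twist \<sigma> f) ^^ n) (\<sigma> x) = \<sigma> ((poly f ^^ n) x)"
  by (induction n) (use assms in \<open>simp_all add: Qbar_subring.poly_mem poly_twist\<close>)

end

text \<open>The group product is \<open>compose Qbar\<close>, which is guaranteed to agree with
  plain composition only on \<open>Qbar\<close>; hence the assumption on the coefficients of
  \<open>f\<close>.\<close>

lemma twist_compose:
  assumes "\<sigma> \<in> galois_auts" "\<tau> \<in> galois_auts" "f \<in> polys_over Qbar"
  shows "twist (\<sigma> \<otimes>\<^bsub>absolute_galois_group\<^esub> \<tau>) f = twist \<sigma> (twist \<tau> f)"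
proof -
  have "\<sigma> \<otimes>\<^bsub>absolute_galois_group\<^esub> \<tau> \<in> galois_auts"
    using assms(1,2) by (intro monoid.m_closed group.is_monoid group_absolute_galois_group)
  moreover have "\<sigma> \<otimes>\<^bsub>absolute_galois_group\<^esub> \<tau> = compose Qbar \<sigma> \<tau>"
    using assms(1,2) by (simp add: absolute_galois_group_def BijGroup_def)
  moreover have "coeff f i \<in> Qbar" for i using assms(3) by (simp add: polys_over_def)
  ultimately show ?thesis
    using assms(1,2)
    by (intro poly_eqI) (simp add: galois_aut.coeff_twist galois_aut_def compose_def)
qed

lemma twist_one: "f \<in> polys_over Qbar \<Longrightarrow> twist \<one>\<^bsub>absolute_galois_group\<^esub> f = f"
proof -
  assume f: "f \<in> polys_over Qbar"
  have "\<one>\<^bsub>absolute_galois_group\<^esub> = (\<lambda>x\<in>Qbar. x)"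
    by (simp add: absolute_galois_group_def BijGroup_def)
  moreover have "\<one>\<^bsub>absolute_galois_group\<^esub> \<in> galois_auts"
    by (intro monoid.one_closed group.is_monoid group_absolute_galois_group)
  ultimately show ?thesis
    using f by (intro poly_eqI) (simp add: galois_aut.coeff_twist galois_aut_def polys_over_def)
qed

text \<open>The order of \<open>z\<close> in f - f(z) exceeds its order in f' by one. Conditions on
  derivatives pass through twists and compositions more easily than orders do.\<close>

lemma local_degree_eq_1_iff:
  assumes "degree f > 0"
  shows "local_degree f z = 1 \<longleftrightarrow> poly (pderiv f) z \<noteq> 0"
proof -
  let ?g = "f - [:poly f z:]"
  have d: "pderiv ?g = pderiv f" by (simp add: pderiv_diff pderiv_pCons)
  have nz: "pderiv f \<noteq> 0" using assms by (simp add: pderiv_eq_0_iff)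
  then have "?g \<noteq> 0" using d by (metis pderiv_0)
  then have "local_degree f z = Suc (Polynomial.order z (pderiv f))"
    using order_pderiv[of ?g z] d by (simp add: local_degree_def)
  then show ?thesis using nz by (simp add: order_root)
qed

lemma local_degree_eq_2_iff:
  assumes "degree f > 1"
  shows "local_degree f z = 2 \<longleftrightarrow> poly (pderiv f) z = 0 \<and> poly (pderiv (pderiv f)) z \<noteq> 0"
proof -
  let ?g = "f - [:poly f z:]"
  have d: "pderiv ?g = pderiv f" by (simp add: pderiv_diff pderiv_pCons)
  have nz: "pderiv f \<noteq> 0" using assms by (simp add: pderiv_eq_0_iff)
  have nz2: "pderiv (pderiv f) \<noteq> 0" using assms by (simp add: pderiv_eq_0_iff degree_pderiv)
  have "?g \<noteq> 0" using d nz by (metis pderiv_0)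
  then have *: "local_degree f z = Suc (Polynomial.order z (pderiv f))"
    using order_pderiv[of ?g z] d by (simp add: local_degree_def)
  show ?thesis
  proof (cases "poly (pderiv f) z = 0")
    case True
    then show ?thesis using * order_pderiv[OF nz True] nz2 by (simp add: order_root)
  next
    case False
    then show ?thesis using * order_0I[OF False] by simp
  qed
qed

text \<open>Taking the closure adds no condition, because the finite set {0, 1} is closed.\<close>

lemma postcritical_set_subset_iff:
  "postcritical_set f \<subseteq> {0, 1} \<longleftrightarrow>
    (\<forall>z n. poly (pderiv f) z = 0 \<longrightarrow> n > 0 \<longrightarrow> (poly f ^^ n) z \<in> {0, 1})"
proof -
  have "closed ({0, 1} :: complex set)" by (simp add: finite_imp_closed)
  then have "postcritical_set f \<subseteq> {0, 1} \<longleftrightarrow>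
      (\<Union>n\<in>{0<..}. (poly f ^^ n) ` critical_points f) \<subseteq> {0, 1}"
    unfolding postcritical_set_def
    using closure_minimal order_trans[OF closure_subset] by (intro iffI)
  also have "\<dots> \<longleftrightarrow> (\<forall>z n. poly (pderiv f) z = 0 \<longrightarrow> n > 0 \<longrightarrow> (poly f ^^ n) z \<in> {0, 1})"
    unfolding critical_points_def by blast
  finally show ?thesis .
qed

text \<open>The condition on critical values is the case n = 1 of the condition on orbits.\<close>

lemma DBP_iff:
  "f \<in> DBP \<longleftrightarrow> f \<in> polys_over Qbar \<and> degree f \<ge> 3 \<and>
     (\<forall>z n. poly (pderiv f) z = 0 \<longrightarrow> n > 0 \<longrightarrow> (poly f ^^ n) z \<in> {0, 1}) \<and>
     (\<forall>z. poly f z = 1 \<longrightarrow> poly (pderiv f) z = 0 \<and> poly (pderiv (pderiv f)) z \<noteq> 0)"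
proof -
  have crit: "critical_values f \<subseteq> {0, 1}"
    if "\<forall>z n. poly (pderiv f) z = 0 \<longrightarrow> n > 0 \<longrightarrow> (poly f ^^ n) z \<in> {0, 1}"
  proof
    fix v assume "v \<in> critical_values f"
    then obtain z where "v = poly f z" "poly (pderiv f) z = 0"
      by (auto simp: critical_values_def critical_points_def)
    then show "v \<in> {0, 1}" using that[rule_format, of z "Suc 0"] by simp
  qed
  show ?thesis
  proof (cases "degree f \<ge> 3")
    case True
    then have "degree f > 1" by simp
    then show ?thesis
      using True crit
      unfolding DBP_def mem_Collect_eq belyi_polynomial_def postcritical_set_subset_iff
        polys_over_def local_degree_eq_2_iff[OF \<open>degree f > 1\<close>] by blast
  qed (simp add: DBP_def)
qed

lemma XDBP_iff:
  "f \<in> XDBP \<longleftrightarrow> f \<in> DBP \<and> poly f 0 = 0 \<and> poly f 1 = 0 \<and>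
     poly (pderiv f) 0 \<noteq> 0 \<and> poly (pderiv f) 1 \<noteq> 0"
proof (cases "f \<in> DBP")
  case True
  then have "degree f > 0" by (simp add: DBP_def)
  with True show ?thesis by (simp add: XDBP_def local_degree_eq_1_iff del: One_nat_def)
qed (simp add: XDBP_def)

context galois_aut
begin

text \<open>The critical points of the twist and its points over 1 are algebraic, hence of the form
  \<sigma> w with w in \<open>Qbar\<close>. Each condition thus reduces to the same condition on
  \<open>f\<close> at w.\<close>

lemma twist_DBP:
  assumes "f \<in> DBP"
  shows "twist \<sigma> f \<in> DBP"
proof -
  have f: "f \<in> polys_over Qbar" "degree f \<ge> 3"
    and crit: "\<And>z n. poly (pderiv f) z = 0 \<Longrightarrow> n > 0 \<Longrightarrow> (poly f ^^ n) z \<in> {0, 1}"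
    and clean: "\<And>z. poly f z = 1 \<Longrightarrow> poly (pderiv f) z = 0 \<and> poly (pderiv (pderiv f)) z \<noteq> 0"
    using assms unfolding DBP_iff by blast+
  note f' = Qbar_subring.pderiv_over[OF f(1)]
  note f'' = Qbar_subring.pderiv_over[OF f']
  note tf = twist_over[OF f(1)]
  note deg = degree_twist[OF f(1)]
  show ?thesis
    unfolding DBP_iff
  proof (intro conjI allI impI)
    show "twist \<sigma> f \<in> polys_over Qbar" by (rule tf)
    show "3 \<le> degree (twist \<sigma> f)" using f(2) deg by simp
  next
    fix z n assume z: "poly (pderiv (twist \<sigma> f)) z = 0" and n: "0 < (n::nat)"
    have "pderiv (twist \<sigma> f) \<noteq> 0" using f(2) deg by (simp add: pderiv_eq_0_iff)
    then have "z \<in> Qbar" using Qbar_root[OF Qbar_subring.pderiv_over[OF tf]] z by blast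
    then obtain w where w: "w \<in> Qbar" "z = \<sigma> w" using preimage by blast
    have "poly (pderiv f) w = 0"
      using z poly_twist[OF f' w(1)] eq_0_iff[OF Qbar_subring.poly_mem[OF f' w(1)]]
      by (simp add: pderiv_twist[OF f(1)] w(2))
    from crit[OF this n] funpow_poly_twist[OF f(1) w(1), of n]
    show "(poly (twist \<sigma> f) ^^ n) z \<in> {0, 1}"
      by (auto simp: w(2) hom_zero hom_one)
  next
    fix z assume z: "poly (twist \<sigma> f) z = 1"
    have "z \<in> Qbar" using Qbar_preimage[OF tf, of z] f(2) deg z Qbar_subring.one_mem by simp
    then obtain w where w: "w \<in> Qbar" "z = \<sigma> w" using preimage by blast
    have "poly f w = 1"
      using z poly_twist[OF f(1) w(1)] eq_1_iff[OF Qbar_subring.poly_mem[OF f(1) w(1)]] by (simp add: w(2))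
    from clean[OF this] show "poly (pderiv (twist \<sigma> f)) z = 0"
        "poly (pderiv (pderiv (twist \<sigma> f))) z \<noteq> 0"
      using poly_twist[OF f' w(1)] poly_twist[OF f'' w(1)]
        eq_0_iff[OF Qbar_subring.poly_mem[OF f' w(1)]] eq_0_iff[OF Qbar_subring.poly_mem[OF f'' w(1)]]
      by (simp_all add: pderiv_twist f(1) f' w(2))
  qed
qed

lemma twist_XDBP:
  assumes "f \<in> XDBP"
  shows "twist \<sigma> f \<in> XDBP"
proof -
  have f: "f \<in> DBP" "f \<in> polys_over Qbar" using assms by (auto simp: XDBP_iff DBP_iff)
  note f' = Qbar_subring.pderiv_over[OF f(2)]
  show ?thesis
    using assms twist_DBP[OF f(1)]
      poly_twist[OF f(2) Qbar_subring.zero_mem] poly_twist[OF f(2) Qbar_subring.one_mem]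
      poly_twist[OF f' Qbar_subring.zero_mem] poly_twist[OF f' Qbar_subring.one_mem]
      eq_0_iff[OF Qbar_subring.poly_mem[OF f' Qbar_subring.zero_mem]] eq_0_iff[OF Qbar_subring.poly_mem[OF f' Qbar_subring.one_mem]]
    by (simp add: XDBP_iff hom_zero hom_one pderiv_twist f(2))
qed

end

text \<open>Twisting by the inverse automorphism also preserves \<open>E\<close>, which gives
  bijectivity; restricting to \<open>E\<close> makes the maps extensional, as \<open>Bij\<close>
  demands.\<close>

lemma twist_group_action:
  assumes E: "E \<subseteq> polys_over Qbar"
    and closed: "\<And>\<sigma> f. \<sigma> \<in> galois_auts \<Longrightarrow> f \<in> E \<Longrightarrow> twist \<sigma> f \<in> E"
  shows "group_action absolute_galois_group E (\<lambda>\<sigma>. \<lambda>f\<in>E. twist \<sigma> f)"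
proof -
  let ?G = absolute_galois_group
  interpret G: group ?G by (rule group_absolute_galois_group)
  have left_inv: "twist (inv\<^bsub>?G\<^esub> \<sigma>) (twist \<sigma> f) = f" if "\<sigma> \<in> galois_auts" "f \<in> E" for \<sigma> f
    using that E twist_compose[of "inv\<^bsub>?G\<^esub> \<sigma>" \<sigma> f] twist_one[of f] by auto
  have right_inv: "twist \<sigma> (twist (inv\<^bsub>?G\<^esub> \<sigma>) f) = f" if "\<sigma> \<in> galois_auts" "f \<in> E" for \<sigma> f
    using that E twist_compose[of \<sigma> "inv\<^bsub>?G\<^esub> \<sigma>" f] twist_one[of f] by auto
  have bij: "(\<lambda>f\<in>E. twist \<sigma> f) \<in> Bij E" if "\<sigma> \<in> galois_auts" for \<sigma>
  proof -
    have "bij_betw (twist \<sigma>) E E"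
      using that closed left_inv right_inv
      by (intro bij_betw_byWitness[where f' = "twist (inv\<^bsub>?G\<^esub> \<sigma>)"]) auto
    then show ?thesis by (simp add: Bij_def bij_betw_restrict_eq)
  qed
  have hom: "(\<lambda>f\<in>E. twist (\<sigma> \<otimes>\<^bsub>?G\<^esub> \<tau>) f) = compose E (\<lambda>f\<in>E. twist \<sigma> f) (\<lambda>f\<in>E. twist \<tau> f)"
    if "\<sigma> \<in> galois_auts" "\<tau> \<in> galois_auts" for \<sigma> \<tau>
    using that closed E twist_compose[OF that] by (auto simp: compose_def fun_eq_iff subset_iff)
  show ?thesis
    unfolding group_action_def group_hom_def group_hom_axioms_def
    using bij hom group_BijGroup by (auto simp: hom_def BijGroup_def G.is_group)
qed

section \<open>Polynomials moved by a given automorphism\<close>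

text \<open>Points of \<open>R\<close> that are not roots contribute 0; this freedom lets the orders
  of different polynomials be summed over one set.\<close>

lemma sum_order_eq_degree:
  fixes p :: "complex poly"
  assumes "p \<noteq> 0" "finite R" "{z. poly p z = 0} \<subseteq> R"
  shows "(\<Sum>z\<in>R. Polynomial.order z p) = degree p"
proof -
  have "degree p = (\<Sum>z\<in>set_mset (proots p). count (proots p) z)"
    by (simp add: size_proots_complex[symmetric] size_multiset_overloaded_eq)
  also have "\<dots> = (\<Sum>z | poly p z = 0. Polynomial.order z p)"
    using assms(1) by simp
  also have "\<dots> = (\<Sum>z\<in>R. Polynomial.order z p)"
    using assms by (intro sum.mono_neutral_left) (auto simp: order_root)
  finally show ?thesis by simp
qed

text \<open>With n = \<open>degree g\<close>, counting multiplicities gives n + 1 points over 0 and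
  1, of which at most n - 1 are critical. In terms of dessins, a plane tree with n edges has n + 1
  vertices, and the noncritical points are its leaves.\<close>

lemma two_noncritical_points_over_branch_values:
  assumes deg: "degree g > 0" and crit: "critical_values g \<subseteq> {0, 1}"
  shows "\<exists>p q. p \<noteq> q \<and> poly g p \<in> {0, 1} \<and> poly g q \<in> {0, 1} \<and>
    poly (pderiv g) p \<noteq> 0 \<and> poly (pderiv g) q \<noteq> 0"
proof -
  define R where "R = {z. poly g z \<in> {0, 1}}"
  define N where "N = {z\<in>R. poly (pderiv g) z \<noteq> 0}"
  let ?g1 = "g - [:1:]"
  let ?ord = "\<lambda>z. Polynomial.order z (pderiv g)"
  have g0: "g \<noteq> 0" using deg by auto
  have g1: "?g1 \<noteq> 0" using deg by (metis degree_pCons_0 eq_iff_diff_eq_0 less_irrefl)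
  have dg: "pderiv ?g1 = pderiv g" by (simp add: pderiv_diff pderiv_pCons)
  have nz: "pderiv g \<noteq> 0" using deg by (simp add: pderiv_eq_0_iff)
  have degu: "degree (g * ?g1) = 2 * degree g"
  proof -
    have "degree ?g1 = degree g"
      unfolding diff_conv_add_uminus using deg by (intro degree_add_eq_left) simp
    then show ?thesis using g0 g1 by (simp add: degree_mult_eq)
  qed
  have R: "R = {z. poly (g * ?g1) z = 0}" by (auto simp: R_def)
  have finR: "finite R" unfolding R using g0 g1 by (intro poly_roots_finite) simp
  \<comment> \<open>At a point of \<open>R\<close> exactly one of the two factors vanishes, and
    differentiation lowers its order by one.\<close>
  have ord: "Polynomial.order z (g * ?g1) = Suc (?ord z)" if "z \<in> R" for z
  proof -
    have *: "Polynomial.order z (g * ?g1) = Polynomial.order z g + Polynomial.order z ?g1"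
      using g0 g1 by (intro order_mult) simp
    show ?thesis
    proof (cases "poly g z = 0")
      case True
      then have "poly ?g1 z \<noteq> 0" by simp
      then show ?thesis using * order_pderiv[OF g0 True] order_0I[of ?g1 z] by simp
    next
      case False
      then have "poly ?g1 z = 0" using that by (simp add: R_def)
      then show ?thesis using * order_pderiv[OF g1] dg order_0I[OF False] by simp
    qed
  qed
  \<comment> \<open>Every root of g' lies in \<open>R\<close>, so the orders of g' over
    \<open>R\<close> add up to its full degree n - 1.\<close>
  have critR: "{z. poly (pderiv g) z = 0} \<subseteq> R"
    using crit by (auto simp: R_def critical_values_def critical_points_def)
  have "2 * degree g = (\<Sum>z\<in>R. Polynomial.order z (g * ?g1))"
    using sum_order_eq_degree[OF _ finR, of "g * ?g1"] g0 g1 degu R by simp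
  also have "\<dots> = card R + (\<Sum>z\<in>R. ?ord z)"
    using ord by (simp add: sum_Suc)
  also have "(\<Sum>z\<in>R. ?ord z) = degree g - 1"
    using sum_order_eq_degree[OF nz finR critR] by (simp add: degree_pderiv)
  finally have "card R = degree g + 1" using deg by simp
  moreover have "card (R - N) \<le> degree g - 1"
  proof -
    have "card (R - N) = (\<Sum>z\<in>R - N. 1)" by simp
    also have "\<dots> \<le> (\<Sum>z\<in>R - N. ?ord z)"
    proof (rule sum_mono)
      fix z assume "z \<in> R - N"
      then have "poly (pderiv g) z = 0" by (simp add: N_def)
      then show "1 \<le> ?ord z" using nz order_gt_0_iff[OF nz, of z] by simp
    qed
    also have "\<dots> \<le> (\<Sum>z\<in>R. ?ord z)" using finR by (intro sum_mono2) auto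
    also have "\<dots> = degree g - 1"
      using sum_order_eq_degree[OF nz finR critR] by (simp add: degree_pderiv)
    finally show ?thesis .
  qed
  moreover have "card R = card N + card (R - N)"
    using finR card_Un_disjoint[of N "R - N"] by (auto simp: N_def Un_absorb1)
  ultimately have "\<not> card N \<le> Suc 0" using deg by linarith
  moreover have "finite N" using finR by (simp add: N_def)
  ultimately obtain p q where "p \<in> N" "q \<in> N" "p \<noteq> q"
    by (auto simp: card_le_Suc0_iff_eq)
  then show ?thesis unfolding N_def R_def by blast
qed

text \<open>Up to a root of unity, \<open>Q\<close> and \<open>R\<close> have the same leading
  coefficient; after rescaling, a difference of positive degree would make the top-degree parts of
  the two composites differ by too much.\<close>

lemma pcompose_eq_imp_affine:
  fixes H Q R :: "'a::field_char_0 poly"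
  assumes H: "degree H > 0" and deg: "degree Q = degree R" and eq: "pcompose H Q = pcompose H R"
  shows "\<exists>c d. Q = smult c R + [:d:]"
proof (cases "degree R = 0")
  case True
  then obtain d where "Q = [:d:]" using deg by (metis degree_eq_zeroE)
  then have "Q = smult 0 R + [:d:]" by simp
  then show ?thesis by blast
next
  case False
  then have n: "degree R > 0" "degree Q > 0" using deg by simp_all
  obtain k where k: "degree H = Suc k" using H by (cases "degree H") auto
  define b where "b = lead_coeff H"
  define H0 where "H0 = H - monom b (Suc k)"
  \<comment> \<open>Scaling \<open>R\<close> by \<open>c\<close> gives it the leading coefficient of
    \<open>Q\<close>. Since the power of \<open>c\<close> with exponent \<open>degree H\<close> is
    1, the scaled \<open>R2\<close> and \<open>R\<close> agree after raising to that
    exponent.\<close>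
  define c where "c = lead_coeff Q / lead_coeff R"
  define R2 where "R2 = smult c R"
  have b0: "b \<noteq> 0" using H by (auto simp: b_def)
  have lQ: "lead_coeff Q \<noteq> 0" and lR: "lead_coeff R \<noteq> 0" using n by auto
  have c0: "c \<noteq> 0" using lQ lR by (simp add: c_def)
  have "b * lead_coeff Q ^ Suc k = b * lead_coeff R ^ Suc k"
    using arg_cong[OF eq, of lead_coeff] lead_coeff_comp[OF n(1), of H] lead_coeff_comp[OF n(2), of H]
    by (simp only: k b_def)
  then have ck: "c ^ Suc k = 1"
    using b0 lR by (simp add: c_def power_divide del: power_Suc)
  have degR2: "degree R2 = degree R" and lR2: "lead_coeff R2 = lead_coeff Q"
    using c0 lR by (simp_all add: R2_def c_def)
  have R2k: "R2 ^ Suc k = R ^ Suc k" using ck by (simp only: R2_def smult_power smult_1_left)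
  have degH0: "degree H0 \<le> k"
  proof (rule degree_le, intro allI impI)
    fix i assume "k < i"
    then show "coeff H0 i = 0"
      using k by (cases "i = Suc k") (auto simp: H0_def b_def coeff_eq_0)
  qed
  have comp: "pcompose H X = smult b (X ^ Suc k) + pcompose H0 X" for X
    by (simp add: H0_def pcompose_diff pcompose_monom del: power_Suc)
  define D where "D = Q - R2"
  define E where "E = (\<Sum>i<Suc k. Q ^ i * R2 ^ (k - i))"
  \<comment> \<open>The top term of \<open>H\<close> contributes a difference of powers, factored as
    \<open>D * E\<close>; the lower terms, of degree at most \<open>k\<close> in \<open>H\<close>,
    must cancel it.\<close>
  have "smult b (D * E) = smult b (Q ^ Suc k - R2 ^ Suc k)"
    unfolding D_def E_def by (simp only: diff_power_eq_sum mult.commute)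
  also have "\<dots> = pcompose H0 R - pcompose H0 Q"
    using eq unfolding comp R2k by (simp add: smult_diff_right algebra_simps del: power_Suc)
  finally have DE: "smult b (D * E) = pcompose H0 R - pcompose H0 Q" .
  have "degree (pcompose H0 X) \<le> degree R * k" if "degree X = degree R" for X
    using degH0 that by (simp add: degree_pcompose mult.commute)
  then have "degree (D * E) \<le> degree R * k"
    using arg_cong[OF DE, of degree] b0 deg degree_diff_le[of "pcompose H0 R" "degree R * k" "pcompose H0 Q"]
    by simp
  \<comment> \<open>All \<open>Suc k\<close> summands of \<open>E\<close> share one leading
    coefficient in this degree, and their sum is nonzero in characteristic 0. So \<open>E\<close>
    already exhausts the degree bound on \<open>D * E\<close>.\<close>
  moreover have Ec: "coeff E (degree R * k) \<noteq> 0"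
  proof -
    have "coeff (Q ^ i * R2 ^ (k - i)) (degree R * k) = lead_coeff Q ^ k" if "i < Suc k" for i
    proof -
      have nz: "Q \<noteq> 0" "R2 \<noteq> 0" using lQ lR2 by auto
      have "degree (Q ^ i * R2 ^ (k - i)) = i * degree R + (k - i) * degree R"
        using nz by (simp add: degree_mult_eq degree_power_eq deg degR2)
      also have "\<dots> = (i + (k - i)) * degree R" by (simp only: distrib_right)
      also have "\<dots> = degree R * k" using that by simp
      finally have "coeff (Q ^ i * R2 ^ (k - i)) (degree R * k) = lead_coeff (Q ^ i * R2 ^ (k - i))"
        by simp
      also have "\<dots> = lead_coeff Q ^ i * lead_coeff Q ^ (k - i)"
        by (simp only: lead_coeff_mult lead_coeff_power lR2)
      also have "\<dots> = lead_coeff Q ^ k" using that by (simp add: power_add[symmetric])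
      finally show ?thesis .
    qed
    then have "coeff E (degree R * k) = of_nat (Suc k) * lead_coeff Q ^ k"
      unfolding E_def coeff_sum by simp
    then show ?thesis using lQ by (simp del: of_nat_Suc)
  qed
  ultimately have "degree D = 0"
  proof (cases "D = 0")
    case False
    have "E \<noteq> 0" "degree R * k \<le> degree E" using Ec by (auto intro: le_degree)
    with False \<open>degree (D * E) \<le> degree R * k\<close> show ?thesis by (simp add: degree_mult_eq)
  qed simp
  then obtain d where "D = [:d:]" by (metis degree_eq_zeroE)
  then have "Q = smult c R + [:d:]" by (simp add: D_def R2_def algebra_simps)
  then show ?thesis by blast
qed

text \<open>The map w |-> 4 w (1 - w) sends 0 and 1 to 0, and its critical point 1/2 to 1. As 1/2 is
  not a critical value of \<open>g\<close>, the composite has local degree exactly 2 over 1.\<close>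

lemma cleaned_belyi_in_XDBP:
  assumes g: "g \<in> polys_over Qbar" "degree g \<ge> 2" "critical_values g \<subseteq> {0, 1}"
    and g01: "poly g 0 \<in> {0, 1}" "poly g 1 \<in> {0, 1}"
    and d01: "poly (pderiv g) 0 \<noteq> 0" "poly (pderiv g) 1 \<noteq> 0"
  shows "pcompose [:0, 4, -4:] g \<in> XDBP"
proof -
  define f where "f = pcompose [:0, 4, -4:] g"
  have pf: "poly f z = 4 * poly g z - 4 * (poly g z)\<^sup>2" for z
    by (simp add: f_def poly_pcompose algebra_simps power2_eq_square)
  have df: "pderiv f = pcompose [:4, -8:] g * pderiv g"
    by (simp add: f_def pderiv_pcompose pderiv_pCons)
  have pdf: "poly (pderiv f) z = (4 - 8 * poly g z) * poly (pderiv g) z" for z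
    by (simp add: df poly_pcompose algebra_simps)
  have pddf: "poly (pderiv (pderiv f)) z =
      (4 - 8 * poly g z) * poly (pderiv (pderiv g)) z - 8 * (poly (pderiv g) z)\<^sup>2" for z
    by (simp add: df pderiv_mult pderiv_pcompose pderiv_pCons poly_pcompose algebra_simps
        power2_eq_square)
  have crit: "poly g z \<in> {0, 1}" if "poly (pderiv g) z = 0" for z
    using g(3) that by (auto simp: critical_values_def critical_points_def)
  have four: "4 \<in> Qbar" using Qbar_subring.of_nat_mem[of 4] by simp
  have over: "f \<in> polys_over Qbar"
    unfolding f_def using four
    by (intro Qbar_subring.pcompose_over g(1) Qbar_subring.pCons_over Qbar_subring.zero_over
        Qbar_subring.zero_mem Qbar_subring.uminus_mem)
  have deg: "degree f \<ge> 3" using g(2) by (simp add: f_def degree_pcompose)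
  have f01: "poly f 0 = 0" "poly f 1 = 0" using g01 by (auto simp: pf)
  have iter: "(poly f ^^ n) v \<in> {0, 1}" if "v \<in> {0, 1}" for v n
    using that f01 by (induction n) auto
  have half: "poly g z = 1/2" if "4 - 8 * poly g z = 0" for z
  proof -
    have "poly g z = 4 / 8" using that by (simp add: field_simps)
    then show ?thesis by simp
  qed
  have fcrit: "poly f z \<in> {0, 1}" if "poly (pderiv f) z = 0" for z
  proof -
    from that consider "4 - 8 * poly g z = 0" | "poly (pderiv g) z = 0" by (auto simp: pdf)
    then show ?thesis
    proof cases
      case 1
      show ?thesis unfolding pf half[OF 1] by (simp add: power2_eq_square)
    next
      case 2
      from crit[OF this] show ?thesis by (auto simp: pf)
    qed
  qed
  have "f \<in> DBP"
    unfolding DBP_iff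
  proof (intro conjI allI impI over deg)
    fix z n assume "poly (pderiv f) z = 0" "0 < (n::nat)"
    \<comment> \<open>The first application lands in {0, 1}, where the remaining n - 1 iterations
      stay.\<close>
    then show "(poly f ^^ n) z \<in> {0, 1}"
      using iter[OF fcrit, of z "n - 1"] by (cases n) (auto simp: funpow_Suc_right simp del: funpow.simps)
  next
    fix z assume "poly f z = 1"
    \<comment> \<open>Completing the square shows that the points over 1 are exactly those where
      \<open>g\<close> takes the value 1/2.\<close>
    moreover have "(4 - 8 * poly g z)\<^sup>2 = 16 * (1 - poly f z)"
      by (simp add: pf power2_eq_square algebra_simps)
    ultimately have "(4 - 8 * poly g z)\<^sup>2 = 0" by simp
    then have z: "4 - 8 * poly g z = 0" by simp
    then show "poly (pderiv f) z = 0" by (simp add: pdf)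
    have "poly (pderiv g) z \<noteq> 0" using half[OF z] crit[of z] by auto
    then show "poly (pderiv (pderiv f)) z \<noteq> 0" unfolding pddf z by simp
  qed
  then show ?thesis
    using f01 d01 g01 unfolding XDBP_iff f_def[symmetric] pdf by auto
qed

text \<open>The antiderivative without constant term of 420 z^3 (z - 1)^2 (z - \<alpha>). The factor
  420 = lcm(4, 5, 6, 7) makes the coefficients integral polynomials in \<alpha>, so twisting only
  replaces \<alpha> by its image.\<close>

definition marked_poly :: "complex \<Rightarrow> complex poly"
  where "marked_poly \<alpha> = [:0, 0, 0, 0, - (105 * \<alpha>), 84 * (1 + 2 * \<alpha>), - (70 * (2 + \<alpha>)), 60:]"

lemma pderiv_marked_poly:
  "pderiv (marked_poly \<alpha>) = smult 420 ([:0, 1:] * [:0, 1:] * [:0, 1:] * [:-1, 1:] * [:-1, 1:] * [:-\<alpha>, 1:])"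
  by (simp add: marked_poly_def pderiv_pCons algebra_simps)

lemma marked_poly_over: "\<alpha> \<in> Qbar \<Longrightarrow> marked_poly \<alpha> \<in> polys_over Qbar"
proof -
  have num: "numeral n \<in> Qbar" for n
    using Qbar_subring.of_nat_mem[of "numeral n"] by simp
  show "\<alpha> \<in> Qbar \<Longrightarrow> marked_poly \<alpha> \<in> polys_over Qbar"
    unfolding marked_poly_def
    by (intro Qbar_subring.pCons_over Qbar_subring.zero_over Qbar_subring.zero_mem num
        Qbar_subring.uminus_mem Qbar_subring.mult_mem Qbar_subring.add_mem Qbar_subring.one_mem)
qed

lemma degree_marked_poly: "degree (marked_poly \<alpha>) = 7"
  by (simp add: marked_poly_def)

lemma (in galois_aut) twist_marked_poly:
  assumes "\<alpha> \<in> Qbar"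
  shows "twist \<sigma> (marked_poly \<alpha>) = marked_poly (\<sigma> \<alpha>)"
proof -
  have num: "numeral n \<in> Qbar" for n
    using Qbar_subring.of_nat_mem[of "numeral n"] by simp
  have fix_num: "\<sigma> (numeral n) = numeral n" for n by (rule fix_Rats) simp
  note [simp] = Qbar_subring.add_mem Qbar_subring.mult_mem Qbar_subring.one_mem Qbar_subring.uminus_mem
  show ?thesis
    using assms unfolding twist_def marked_poly_def
    by (simp add: map_hom_pCons hom_zero hom_one hom_uminus hom_mult hom_add num fix_num
        del: mult_minus_left minus_add_distrib)
qed

lemma order_linear:
  fixes a b :: "'a::field_char_0"
  assumes "b \<noteq> 0"
  shows "Polynomial.order z [:a, b:] = (if a + b * z = 0 then 1 else 0)"
proof (cases "a + b * z = 0")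
  case True
  then have "poly [:a, b:] z = 0" by (simp add: mult.commute)
  then show ?thesis using order_pderiv[of "[:a, b:]" z] assms True
    by (simp add: pderiv_pCons order_0I)
next
  case False
  then show ?thesis by (simp add: order_0I mult.commute)
qed

text \<open>As \<alpha> avoids 0 and 1, the multiplicities 3, 2 and 1 label three different points,
  still recognisable after an affine change of variable.\<close>

lemma order_pderiv_marked_poly_affine:
  assumes "b \<noteq> 0" "\<alpha> \<noteq> 0" "\<alpha> \<noteq> 1"
  shows "Polynomial.order z (pcompose (pderiv (marked_poly \<alpha>)) [:a, b:]) =
    (if a + b * z = 0 then 3 else if a + b * z = 1 then 2 else if a + b * z = \<alpha> then 1 else 0)"
proof -
  have e: "pcompose (pderiv (marked_poly \<alpha>)) [:a, b:] =
      smult 420 ([:a, b:] * [:a, b:] * [:a, b:] * [:a - 1, b:] * [:a - 1, b:] * [:a - \<alpha>, b:])"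
    unfolding pderiv_marked_poly pcompose_smult pcompose_mult by (simp add: pcompose_pCons)
  have nz: "[:x, b:] \<noteq> 0" for x using assms(1) by simp
  have root: "a - t + b * z = 0 \<longleftrightarrow> a + b * z = t" for t by (auto simp: algebra_simps)
  show ?thesis
    unfolding e using assms
    by (auto simp: root order_smult order_mult order_linear nz simp del: mult_pCons_left mult_pCons_right)
qed

lemma (in galois_aut) exists_XDBP_moved:
  assumes \<alpha>: "\<alpha> \<in> Qbar" "\<sigma> \<alpha> \<noteq> \<alpha>"
  shows "\<exists>f\<in>XDBP. twist \<sigma> f \<noteq> f"
proof -
  define P where "P = marked_poly \<alpha>"
  have P: "P \<in> polys_over Qbar" "degree P = 7"
    using \<alpha>(1) by (simp_all add: P_def marked_poly_over degree_marked_poly)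
  have \<alpha>01: "\<alpha> \<noteq> 0" "\<alpha> \<noteq> 1" using \<alpha>(2) hom_zero hom_one by auto
  have s\<alpha>01: "\<sigma> \<alpha> \<noteq> 0" "\<sigma> \<alpha> \<noteq> 1" using \<alpha>01 eq_0_iff[OF \<alpha>(1)] eq_1_iff[OF \<alpha>(1)] by auto
  have "finite (critical_values P)"
    using finite_critical_points[of P] P(2) by (simp add: critical_values_def)
  moreover have "critical_values P \<subseteq> Qbar"
  proof
    fix v assume "v \<in> critical_values P"
    then obtain z where z: "poly (pderiv P) z = 0" "v = poly P z"
      by (auto simp: critical_values_def critical_points_def)
    have "pderiv P \<noteq> 0" using P(2) by (simp add: pderiv_eq_0_iff)
    then have "z \<in> Qbar" using Qbar_root[OF Qbar_subring.pderiv_over[OF P(1)]] z(1) by blast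
    then show "v \<in> Qbar" using z(2) Qbar_subring.poly_mem[OF P(1)] by simp
  qed
  ultimately obtain B where B: "B \<in> polys_over \<rat>" "degree B > 0"
      "critical_values B \<subseteq> {0, 1}" "poly B ` critical_values P \<subseteq> {0, 1}"
    using belyi by metis
  define g where "g = pcompose B P"
  have g: "g \<in> polys_over Qbar" "degree g > 0"
    using B(1,2) P by (simp_all add: g_def Qbar_subring.pcompose_over Rats_over_Qbar degree_pcompose)
  have g_crit: "critical_values g \<subseteq> {0, 1}"
    using critical_values_pcompose[of B P] Un_least[OF B(3,4)] unfolding g_def by (rule order_trans)
  from two_noncritical_points_over_branch_values[OF g(2) g_crit]
  obtain p q where pq: "p \<noteq> q" "poly g p \<in> {0, 1}" "poly g q \<in> {0, 1}"
    "poly (pderiv g) p \<noteq> 0" "poly (pderiv g) q \<noteq> 0" by (elim exE conjE)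
  have "{0, 1} \<subseteq> Qbar" using Qbar_subring.zero_mem Qbar_subring.one_mem by simp
  then have mem: "p \<in> Qbar" "q \<in> Qbar"
    using pq(2,3) Qbar_preimage[OF g] by blast+
  \<comment> \<open>This slope makes the affine map \<open>A\<close> send 0 to \<open>p\<close> and
    1 to \<open>q\<close>.\<close>
  define b where "b = q - p"
  have b: "b \<noteq> 0" "b \<in> Qbar" using pq(1) mem by (simp_all add: b_def Qbar_subring.diff_mem)
  define A where "A = [:p, b:]"
  have A: "A \<in> polys_over Qbar" "degree A = 1"
    using b mem by (simp_all add: A_def Qbar_subring.pCons_over Qbar_subring.zero_over)
  have A01: "poly A 0 = p" "poly A 1 = q" by (simp_all add: A_def b_def)
  define f where "f = pcompose [:0, 4, -4:] (pcompose g A)"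
  have "f \<in> XDBP"
    unfolding f_def
  proof (rule cleaned_belyi_in_XDBP)
    show "pcompose g A \<in> polys_over Qbar" by (rule Qbar_subring.pcompose_over[OF g(1) A(1)])
    show "2 \<le> degree (pcompose g A)"
      using A(2) P(2) B(2) by (simp add: degree_pcompose g_def)
    have "critical_values A = {}" unfolding A_def by (rule critical_values_linear[OF b(1)])
    then show "critical_values (pcompose g A) \<subseteq> {0, 1}"
      using critical_values_pcompose[of g A] g_crit by simp
    show "poly (pcompose g A) 0 \<in> {0, 1}" "poly (pcompose g A) 1 \<in> {0, 1}"
      using pq(2,3) by (simp_all add: poly_pcompose A01)
    have "pderiv A = [:b:]" by (simp add: A_def pderiv_pCons)
    then show "poly (pderiv (pcompose g A)) 0 \<noteq> 0" "poly (pderiv (pcompose g A)) 1 \<noteq> 0"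
      using pq(4,5) b(1) by (simp_all add: pderiv_pcompose poly_pcompose A01)
  qed
  moreover have "twist \<sigma> f \<noteq> f"
  proof
    assume fixed: "twist \<sigma> f = f"
    define H where "H = pcompose [:0, 4, -4:] B"
    define R where "R = pcompose P A"
    have H: "H \<in> polys_over \<rat>" "degree H > 0"
      using B(1,2) unfolding H_def
      by (auto simp: degree_pcompose intro!: Rats_subring.pcompose_over Rats_subring.pCons_over
          Rats_subring.zero_over)
    have R: "R \<in> polys_over Qbar" "degree R = 7"
      using P A by (simp_all add: R_def Qbar_subring.pcompose_over degree_pcompose)
    \<comment> \<open>Regrouping puts everything rational into the outer factor \<open>H\<close>,
      which \<sigma> fixes; only \<open>R\<close> is twisted.\<close>
    have f_eq: "f = pcompose H R" by (simp add: f_def H_def R_def g_def pcompose_assoc)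
    have "pcompose H (twist \<sigma> R) = pcompose H R"
      using fixed map_hom_pcompose[OF Rats_over_Qbar[OF H(1)] R(1)] twist_Rats[OF H(1)]
      by (simp add: f_eq twist_def)
    then obtain c d where cd: "twist \<sigma> R = smult c R + [:d:]"
      using pcompose_eq_imp_affine[OF H(2) degree_twist[OF R(1)]] by blast
    have "c \<noteq> 0"
    proof
      assume "c = 0"
      then have "degree (twist \<sigma> R) = 0" using cd by simp
      then show False using degree_twist[OF R(1)] R(2) by simp
    qed
    define p' where "p' = \<sigma> p"
    define b' where "b' = \<sigma> b"
    have b'0: "b' \<noteq> 0" using b eq_0_iff by (simp add: b'_def)
    have twA: "twist \<sigma> A = [:p', b':]"
      by (simp add: twist_def A_def map_hom_pCons p'_def b'_def)
    have "twist \<sigma> R = pcompose (marked_poly (\<sigma> \<alpha>)) [:p', b':]"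
      using map_hom_pcompose[OF P(1) A(1)] twist_marked_poly[OF \<alpha>(1)] twA
      by (simp add: R_def P_def twist_def)
    then have "pderiv (twist \<sigma> R) = smult b' (pcompose (pderiv (marked_poly (\<sigma> \<alpha>))) [:p', b':])"
      by (simp add: pderiv_pcompose pderiv_pCons)
    moreover have "pderiv (twist \<sigma> R) = smult (c * b) (pcompose (pderiv (marked_poly \<alpha>)) [:p, b:])"
      unfolding cd by (simp add: pderiv_add pderiv_smult R_def P_def A_def pderiv_pcompose pderiv_pCons)
    ultimately have "smult b' (pcompose (pderiv (marked_poly (\<sigma> \<alpha>))) [:p', b':]) =
        smult (c * b) (pcompose (pderiv (marked_poly \<alpha>)) [:p, b:])" by simp
    \<comment> \<open>Differentiation removed \<open>d\<close>, and the nonzero constant factors do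
      not affect orders.\<close>
    then have ord: "Polynomial.order z (pcompose (pderiv (marked_poly (\<sigma> \<alpha>))) [:p', b':]) =
        Polynomial.order z (pcompose (pderiv (marked_poly \<alpha>)) [:p, b:])" for z
      using b'0 \<open>c \<noteq> 0\<close> b(1) by (metis order_smult mult_eq_0_iff)
    note ord = ord[unfolded order_pderiv_marked_poly_affine[OF b'0 s\<alpha>01]
        order_pderiv_marked_poly_affine[OF b(1) \<alpha>01]]
    \<comment> \<open>At the point that \<open>A\<close> sends to \<open>t\<close>, equal orders
      force the twisted affine map to take the value with the same label.\<close>
    have marked: "p' + b' * ((t - p) / b) = (if t = \<alpha> then \<sigma> \<alpha> else t)" if "t \<in> {0, 1, \<alpha>}" for t
    proof -
      have "p + b * ((t - p) / b) = t" using b(1) by simp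
      with ord[of "(t - p) / b"] that \<alpha>01 show ?thesis by (auto split: if_splits)
    qed
    have m0: "p' + b' * ((0 - p) / b) = 0" and m1: "p' + b' * ((1 - p) / b) = 1"
      and m\<alpha>: "p' + b' * ((\<alpha> - p) / b) = \<sigma> \<alpha>"
      using marked[of 0] marked[of 1] marked[of \<alpha>] \<alpha>01 by auto
    \<comment> \<open>The difference of the equations for 1 and 0 gives equal slopes; the equation
      for 0 then gives p' = p, so the equation for \<alpha> reads \<sigma> \<alpha> =
      \<alpha>.\<close>
    have "b' = b" using m0 m1 b(1) by (simp add: field_simps)
    with m0 m\<alpha> b(1) have "\<sigma> \<alpha> = \<alpha>" by (simp add: field_simps)
    with \<alpha>(2) show False ..
  qed
  ultimately show ?thesis by blast
qed

text \<open>Both \<sigma> and the identity element are \<open>undefined\<close> off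
  \<open>Qbar\<close>, so if they differ, \<sigma> moves an algebraic number.\<close>

lemma exists_XDBP_moved_nontrivial:
  assumes "\<sigma> \<in> galois_auts" "\<sigma> \<noteq> \<one>\<^bsub>absolute_galois_group\<^esub>"
  shows "\<exists>f\<in>XDBP. twist \<sigma> f \<noteq> f"
proof -
  have "\<sigma> \<in> extensional Qbar" using assms(1) by (simp add: galois_auts_iff Bij_def)
  moreover have "\<one>\<^bsub>absolute_galois_group\<^esub> = (\<lambda>x\<in>Qbar. x)"
    by (simp add: absolute_galois_group_def BijGroup_def)
  ultimately obtain \<alpha> where "\<alpha> \<in> Qbar" "\<sigma> \<alpha> \<noteq> \<alpha>"
    using assms(2) extensionalityI[of \<sigma> Qbar "\<lambda>x\<in>Qbar. x"] by auto
  then show ?thesis using assms(1) by (intro galois_aut.exists_XDBP_moved) (simp_all add: galois_aut_def)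
qed

theorem theorem3p6:
  shows "faithful_action absolute_galois_group XDBP (\<lambda>\<sigma>. \<lambda>f\<in>XDBP. twist \<sigma> f) \<and>
         faithful_action absolute_galois_group DBP (\<lambda>\<sigma>. \<lambda>f\<in>DBP. twist \<sigma> f)"
proof -
  have sub: "XDBP \<subseteq> DBP" by (auto simp: XDBP_def)
  have over: "DBP \<subseteq> polys_over Qbar" by (auto simp: DBP_iff)
  have "group_action absolute_galois_group XDBP (\<lambda>\<sigma>. \<lambda>f\<in>XDBP. twist \<sigma> f)"
    using sub over by (intro twist_group_action galois_aut.twist_XDBP) (auto simp: galois_aut_def)
  moreover have "group_action absolute_galois_group DBP (\<lambda>\<sigma>. \<lambda>f\<in>DBP. twist \<sigma> f)"
    using over by (intro twist_group_action galois_aut.twist_DBP) (auto simp: galois_aut_def)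
  \<comment> \<open>An element of \<open>XDBP\<close> that is moved lies in \<open>DBP\<close> as
    well, so one witness settles both actions.\<close>
  ultimately show ?thesis
    unfolding faithful_action_iff_moves
    using exists_XDBP_moved_nontrivial sub by fastforce
qed

end
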